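(* Let $k\ge1$ be an integer and let $\vec G=(V,\vec E)$ be a directed graph whose underlying undirected graph is $6k$-edge-connected. Then for every $\mathbb{Z}_{2k+1}$-boundary $\beta$, $\vec G$ has a $\mathbb{Z}_{2k+1}$-flow $f$ with boundary $\beta$ such that $f(\vec e)\in\{0,1\}\pmod{2k+1}$ for every $\vec e\in\vec E$.
   Context: Graphs are finite and may have multiple edges but no loops. A $\mathbb{Z}_{2k+1}$-boundary is a map $\beta:V\to\mathbb{Z}_{2k+1}$ with $\sum_{v\in V}\beta(v)\equiv0\pmod{2k+1}$. For $v\in V$, $\delta^+_{\vec G}(v)$ (resp. $\delta^-_{\vec G}(v)$) is the set of arcs leaving (resp. entering) $v$. A $\mathbb{Z}_{2k+1}$-flow with boundary $\beta$ is a map $f:\vec E\to\mathbb{Z}_{2k+1}$ with $\sum_{\vec e\in\delta^+_{\vec G}(v)}f(\vec e)-\sum_{\vec e\in\delta^-_{\vec G}(v)}f(\vec e)\equiv\beta(v)\pmod{2k+1}$ for every $v\in V$. *)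

theory Defs
  imports "HOL-Number_Theory.Cong"
begin

definition multidigraph :: "'v set \<Rightarrow> 'a set \<Rightarrow> ('a \<Rightarrow> 'v) \<Rightarrow> ('a \<Rightarrow> 'v) \<Rightarrow> bool" where
  "multidigraph V A tail head \<longleftrightarrow> finite V \<and> finite A \<and>
     (\<forall>a\<in>A. tail a \<in> V \<and> head a \<in> V \<and> tail a \<noteq> head a)"

definition cut_arcs :: "'a set \<Rightarrow> ('a \<Rightarrow> 'v) \<Rightarrow> ('a \<Rightarrow> 'v) \<Rightarrow> 'v set \<Rightarrow> 'a set" where
  "cut_arcs A tail head X = {a\<in>A. (tail a \<in> X) \<noteq> (head a \<in> X)}"

definition edge_connected :: "nat \<Rightarrow> 'v set \<Rightarrow> 'a set \<Rightarrow> ('a \<Rightarrow> 'v) \<Rightarrow> ('a \<Rightarrow> 'v) \<Rightarrow> bool" where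
  "edge_connected l V A tail head \<longleftrightarrow>
     (\<forall>X. X \<subseteq> V \<and> X \<noteq> {} \<and> X \<noteq> V \<longrightarrow> l \<le> card (cut_arcs A tail head X))"

definition out_arcs :: "'a set \<Rightarrow> ('a \<Rightarrow> 'v) \<Rightarrow> 'v \<Rightarrow> 'a set" where
  "out_arcs A tail v = {a\<in>A. tail a = v}"

definition in_arcs :: "'a set \<Rightarrow> ('a \<Rightarrow> 'v) \<Rightarrow> 'v \<Rightarrow> 'a set" where
  "in_arcs A head v = {a\<in>A. head a = v}"

text \<open>Z_m-boundary, with elements of Z_m represented by integers (mod m).\<close>
definition is_boundary :: "int \<Rightarrow> 'v set \<Rightarrow> ('v \<Rightarrow> int) \<Rightarrow> bool" where
  "is_boundary m V \<beta> \<longleftrightarrow> [(\<Sum>v\<in>V. \<beta> v) = 0] (mod m)"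

definition is_flow_with_boundary ::
  "int \<Rightarrow> 'v set \<Rightarrow> 'a set \<Rightarrow> ('a \<Rightarrow> 'v) \<Rightarrow> ('a \<Rightarrow> 'v) \<Rightarrow> ('v \<Rightarrow> int) \<Rightarrow> ('a \<Rightarrow> int) \<Rightarrow> bool" where
  "is_flow_with_boundary m V A tail head \<beta> f \<longleftrightarrow>
     (\<forall>v\<in>V. [(\<Sum>a\<in>out_arcs A tail v. f a) - (\<Sum>a\<in>in_arcs A head v. f a) = \<beta> v] (mod m))"

end

theory Submission
  imports Defs
begin

text \<open>
  Following Lovasz, Thomassen, Wu and Zhang, one proves a statement that survives induction: with
  \<open>m = 2k + 1\<close>, the orientation of the edges at one special vertex is prescribed, and every vertex set
  \<open>A\<close> avoiding it has degree at least \<open>2m - 2\<close> plus the distance of its demand \<open>\<tau>(A)\<close> to \<open>2m\<int>\<close>, while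
  the special vertex has degree at most that bound; one vertex of demand 0 is exempt. (Working modulo
  \<open>2m\<close> records the parity of the degrees.) If a set \<open>A\<close> with at least two vertices attains the bound,
  contract \<open>A\<close>, and then use its complement as the special vertex for the inside of \<open>A\<close>. Otherwise all
  such sets have slack 2 and single edges can be removed: a vertex of demand 0 is exempted and lifted
  away; an edge joining a positive to a negative vertex is oriented and deleted; if all demands are
  positive, either an edge \<open>xy\<close> is oriented from \<open>x\<close> and its end at \<open>x\<close> is moved to the special vertex,
  or an edge at the special vertex is deleted, or the special vertex is a source of degree \<open>2m - 1\<close>. In
  the last case one may add edges from a vertex \<open>y\<close> to the special vertex until the demand of \<open>y\<close>
  passes \<open>m\<close> and becomes negative.
\<close>

subsection \<open>Distance to the multiples of an even modulus\<close>

locale half_modulus =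
  fixes m :: int
  assumes m_ge_2: "2 \<le> m"
begin

definition nd :: "int \<Rightarrow> int" where
  "nd a = min (a mod (2 * m)) ((- a) mod (2 * m))"

text \<open>The residue \<open>m\<close> counts as positive, so there both \<open>a\<close> and
  \<open>- a\<close> are positive. This is exactly the range in which subtracting 1 brings
  \<open>a\<close> nearer to a multiple of \<open>2 * m\<close>.\<close>

definition pos :: "int \<Rightarrow> bool" where
  "pos a \<longleftrightarrow> 0 < a mod (2 * m) \<and> a mod (2 * m) \<le> m"

lemma nd_nonneg: "0 \<le> nd a"
  using m_ge_2 by (simp add: nd_def)

lemma nd_minus [simp]: "nd (- a) = nd a"
  by (simp add: nd_def min.commute)

lemma nd_cong: "2 * m dvd a - b \<Longrightarrow> nd a = nd b"
  unfolding nd_def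
  by (metis mod_eq_dvd_iff mod_minus_cong)

lemma nd_small:
  assumes "\<bar>r\<bar> \<le> m"
  shows "nd r = \<bar>r\<bar>"
proof -
  have *: "nd r = r" if "0 \<le> r" "r \<le> m" for r
  proof (cases "r = 0")
    case True
    then show ?thesis by (simp add: nd_def)
  next
    case False
    have "r mod (2 * m) = r" "(- r) mod (2 * m) = 2 * m - r"
      using that m_ge_2 False by (simp_all add: zmod_zminus1_eq_if)
    with that show ?thesis by (simp add: nd_def)
  qed
  show ?thesis
    using *[of r] *[of "- r"] assms by (cases "0 \<le> r") auto
qed

text \<open>A representative of least absolute value turns \<open>nd\<close> into an absolute value,
  from which the triangle inequality and the parity rule are inherited.\<close>

lemma nd_rep: "\<exists>r. 2 * m dvd a - r \<and> \<bar>r\<bar> = nd a \<and> \<bar>r\<bar> \<le> m"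
proof -
  let ?b = "a mod (2 * m)"
  have b: "0 \<le> ?b" "?b < 2 * m" "2 * m dvd a - ?b"
    using m_ge_2 by (auto simp: mod_eq_dvd_iff[symmetric])
  show ?thesis
  proof (cases "?b \<le> m")
    case True
    have "nd a = nd ?b" using b(3) by (rule nd_cong)
    with True b nd_small[of ?b] show ?thesis by (intro exI[of _ ?b]) auto
  next
    case False
    have d: "2 * m dvd a - (?b - 2 * m)"
      using b(3) by (metis diff_diff_eq2 dvd_add_triv_right_iff add_diff_eq diff_add_eq)
    have "nd a = nd (?b - 2 * m)" using d by (rule nd_cong)
    with False b d nd_small[of "?b - 2 * m"] show ?thesis
      by (intro exI[of _ "?b - 2 * m"]) auto
  qed
qed

lemma nd_le: "nd a \<le> m"
  using nd_rep[of a] by auto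

lemma nd_le_abs: "nd a \<le> \<bar>a\<bar>"
proof (cases "\<bar>a\<bar> \<le> m")
  case True
  then show ?thesis by (simp add: nd_small)
next
  case False
  then show ?thesis using nd_le[of a] by linarith
qed

lemma nd_triangle: "nd (a + b) \<le> nd a + nd b"
proof -
  obtain r where r: "2 * m dvd a - r" "\<bar>r\<bar> = nd a" using nd_rep by blast
  obtain s where s: "2 * m dvd b - s" "\<bar>s\<bar> = nd b" using nd_rep by blast
  have "2 * m dvd (a + b) - (r + s)"
    using dvd_add[OF r(1) s(1)] by (simp add: algebra_simps)
  then have "nd (a + b) = nd (r + s)" by (rule nd_cong)
  also have "\<dots> \<le> \<bar>r\<bar> + \<bar>s\<bar>" using nd_le_abs[of "r + s"] by linarith
  finally show ?thesis using r s by simp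
qed

lemma nd_add_le: "nd (a + i) \<le> nd a + \<bar>i\<bar>"
  using nd_triangle[of a i] nd_le_abs[of i] by linarith

text \<open>The modulus is even, so passing to a nearest representative keeps the parity.\<close>

lemma nd_parity: "even (nd a) \<longleftrightarrow> even a"
proof -
  obtain r where r: "2 * m dvd a - r" "\<bar>r\<bar> = nd a" using nd_rep by blast
  have "even (a - r)" using r(1) by (metis dvd_mult_left)
  moreover have "nd a = r \<or> nd a = - r" using r(2) by linarith
  ultimately show ?thesis by auto
qed

lemma nd_eq_0_iff: "nd a = 0 \<longleftrightarrow> 2 * m dvd a"
proof
  assume "nd a = 0"
  then show "2 * m dvd a" using nd_rep[of a] by auto
next
  assume "2 * m dvd a"
  then show "nd a = 0" using nd_cong[of a 0] by (simp add: nd_small nd_def)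
qed

lemma pos_nd: "pos a \<Longrightarrow> nd a = a mod (2 * m)"
proof -
  assume a: "pos a"
  have "nd a = nd (a mod (2 * m))"
    by (rule nd_cong) (simp add: mod_eq_dvd_iff[symmetric])
  then show ?thesis using a by (simp add: pos_def nd_small)
qed

lemma pos_nd_diff_1: "pos a \<Longrightarrow> nd (a - 1) = nd a - 1"
proof -
  assume a: "pos a"
  have "2 * m dvd (a - 1) - (a mod (2 * m) - 1)"
    by (simp add: mod_eq_dvd_iff[symmetric])
  then have "nd (a - 1) = nd (a mod (2 * m) - 1)" by (rule nd_cong)
  then show ?thesis using a by (simp add: pos_nd) (simp add: pos_def nd_small)
qed

lemma neg_nd_add_1: "pos (- a) \<Longrightarrow> nd (a + 1) = nd a - 1"
  using pos_nd_diff_1[of "- a"] nd_minus[of "a + 1"] by simp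

lemma pos_cases:
  assumes "\<not> 2 * m dvd a"
  shows "pos a \<or> pos (- a)"
proof -
  have "a mod (2 * m) \<noteq> 0" using assms by auto
  moreover have "0 \<le> a mod (2 * m)" "a mod (2 * m) < 2 * m" using m_ge_2 by auto
  ultimately show ?thesis
    by (auto simp: pos_def zmod_zminus1_eq_if)
qed

text \<open>Converse to \<open>pos_nd_diff_1\<close>: from residue 0, or from a residue above
  \<open>m\<close>, subtracting 1 moves away from the nearest multiple.\<close>

lemma nd_decreasing_imp_pos:
  assumes "nd (a - 1) < nd a"
  shows "pos a"
proof (rule ccontr)
  assume n: "\<not> pos a"
  show False
  proof (cases "2 * m dvd a")
    case True
    then show False using assms nd_eq_0_iff[of a] nd_nonneg[of "a - 1"] by simp
  next
    case False
    with n pos_cases have p: "pos (- a)" by blast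
    have b: "(- a) mod (2 * m) < m"
      using n p m_ge_2 False by (auto simp: pos_def zmod_zminus1_eq_if split: if_splits)
    have "2 * m dvd (- a + 1) - ((- a) mod (2 * m) + 1)"
      by (simp add: mod_eq_dvd_iff[symmetric])
    then have "nd (- a + 1) = nd ((- a) mod (2 * m) + 1)" by (rule nd_cong)
    also have "\<dots> = (- a) mod (2 * m) + 1"
      using p b by (simp add: pos_def nd_small)
    finally have "nd (- a + 1) = nd (- a) + 1" using pos_nd[OF p] by simp
    then show False using assms nd_minus[of "a - 1"] by simp
  qed
qed

end

subsection \<open>Orientations of weighted graphs\<close>

text \<open>A loopless multigraph is kept as its matrix of multiplicities over the whole type; the
  vertex set enters only through sums over \<open>U\<close>.\<close>

definition mgraph :: "('v \<Rightarrow> 'v \<Rightarrow> int) \<Rightarrow> bool" where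
  "mgraph w \<longleftrightarrow> (\<forall>x y. 0 \<le> w x y \<and> w x y = w y x) \<and> (\<forall>x. w x x = 0)"

text \<open>\<open>f x y\<close> stands for the number of arcs from \<open>x\<close> to
  \<open>y\<close> minus the number back. Bound and parity say that such a splitting of the
  \<open>w x y\<close> parallel edges exists, so single edges need no names.\<close>

definition orients :: "('v \<Rightarrow> 'v \<Rightarrow> int) \<Rightarrow> ('v \<Rightarrow> 'v \<Rightarrow> int) \<Rightarrow> bool" where
  "orients w f \<longleftrightarrow> (\<forall>x y. f y x = - f x y \<and> \<bar>f x y\<bar> \<le> w x y \<and> even (w x y - f x y))"

definition edge :: "'v \<Rightarrow> 'v \<Rightarrow> 'v \<Rightarrow> 'v \<Rightarrow> int" where
  "edge p q x y = (if (x = p \<and> y = q) \<or> (x = q \<and> y = p) then 1 else 0)"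

definition arc :: "'v \<Rightarrow> 'v \<Rightarrow> 'v \<Rightarrow> 'v \<Rightarrow> int" where
  "arc p q x y = (if x = p \<and> y = q then 1 else if x = q \<and> y = p then - 1 else 0)"

text \<open>Both increments apply if \<open>p = q\<close>; with second increment 0 this also covers
  a change at one vertex.\<close>

definition upd :: "'v \<Rightarrow> 'v \<Rightarrow> int \<Rightarrow> int \<Rightarrow> ('v \<Rightarrow> int) \<Rightarrow> 'v \<Rightarrow> int" where
  "upd p q a b g x = g x + (if x = p then a else 0) + (if x = q then b else 0)"

definition cut_size :: "'v set \<Rightarrow> ('v \<Rightarrow> 'v \<Rightarrow> int) \<Rightarrow> 'v set \<Rightarrow> int" where
  "cut_size U w A = (\<Sum>x\<in>A. \<Sum>y\<in>U - A. w x y)"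

text \<open>\<open>sum c A\<close> counts the edges from \<open>A\<close> to the special vertex, so
  this is the degree of \<open>A\<close> in the graph that includes that vertex.\<close>

definition deg :: "'v set \<Rightarrow> ('v \<Rightarrow> 'v \<Rightarrow> int) \<Rightarrow> ('v \<Rightarrow> int) \<Rightarrow> 'v set \<Rightarrow> int" where
  "deg U w c A = cut_size U w A + sum c A"

lemma sum_upd:
  assumes "finite A"
  shows "sum (upd p q a b g) A = sum g A + (if p \<in> A then a else 0) + (if q \<in> A then b else 0)"
  using assms by (simp add: upd_def sum.distrib)

lemma sum_edge:
  assumes "finite U" "p \<noteq> q"
  shows "(\<Sum>y\<in>U. edge p q x y) = (if x = p \<and> q \<in> U \<or> x = q \<and> p \<in> U then 1 else 0)"
proof -
  have "(\<Sum>y\<in>U. edge p q x y)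
      = (\<Sum>y\<in>U. (if y = q then if x = p then 1 else 0 else 0) + (if y = p then if x = q then 1 else 0 else 0))"
    using assms by (intro sum.cong) (auto simp: edge_def)
  then show ?thesis using assms by (auto simp: sum.distrib)
qed

lemma sum_arc:
  assumes "finite U" "p \<noteq> q"
  shows "(\<Sum>y\<in>U. arc p q x y) = (if x = p \<and> q \<in> U then 1 else if x = q \<and> p \<in> U then - 1 else 0)"
proof -
  have "(\<Sum>y\<in>U. arc p q x y)
      = (\<Sum>y\<in>U. (if y = q then if x = p then 1 else 0 else 0) + (if y = p then if x = q then - 1 else 0 else 0))"
    using assms by (intro sum.cong) (auto simp: arc_def)
  then show ?thesis using assms by (auto simp: sum.distrib)
qed

lemma cut_size_edge:
  assumes "finite U" "A \<subseteq> U" "p \<in> U" "q \<in> U" "p \<noteq> q"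
  shows "cut_size U (edge p q) A = (if (p \<in> A) = (q \<in> A) then 0 else 1)"
proof -
  have fin: "finite A" using assms finite_subset by blast
  have "cut_size U (edge p q) A = (\<Sum>x\<in>A. (if x = p then if q \<in> U - A then 1 else 0 else 0)
      + (if x = q then if p \<in> U - A then 1 else 0 else 0))"
    unfolding cut_size_def using assms by (intro sum.cong) (auto simp: sum_edge)
  then show ?thesis using assms fin by (auto simp: sum.distrib)
qed

lemma cut_size_add: "cut_size U (\<lambda>x y. w x y + v x y) A = cut_size U w A + cut_size U v A"
  by (simp add: cut_size_def sum.distrib)

lemma cut_size_diff: "cut_size U (\<lambda>x y. w x y - v x y) A = cut_size U w A - cut_size U v A"
  by (simp add: cut_size_def sum_subtractf)

lemma cut_size_commute:
  assumes "mgraph w" "A \<subseteq> U"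
  shows "cut_size U w (U - A) = cut_size U w A"
proof -
  have "U - (U - A) = A" using assms by blast
  then show ?thesis
    unfolding cut_size_def using assms
    by (subst sum.swap) (simp add: mgraph_def)
qed

lemma even_sum_symmetric:
  assumes "finite A" "mgraph w"
  shows "even (\<Sum>x\<in>A. \<Sum>y\<in>A. w x y)"
  using assms(1)
proof induction
  case empty
  then show ?case by simp
next
  case (insert a A)
  have "(\<Sum>x\<in>insert a A. \<Sum>y\<in>insert a A. w x y)
      = w a a + (\<Sum>y\<in>A. w a y) + ((\<Sum>x\<in>A. w x a) + (\<Sum>x\<in>A. \<Sum>y\<in>A. w x y))"
    using insert by (simp add: sum.distrib)
  also have "(\<Sum>x\<in>A. w x a) = (\<Sum>y\<in>A. w a y)"
    using assms(2) by (intro sum.cong) (auto simp: mgraph_def)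
  finally show ?case using insert assms(2) by (simp add: mgraph_def)
qed

lemma sum_degrees:
  assumes "finite U" "A \<subseteq> U"
  shows "(\<Sum>x\<in>A. \<Sum>y\<in>U. w x y) = cut_size U w A + (\<Sum>x\<in>A. \<Sum>y\<in>A. w x y)"
proof -
  have "(\<Sum>y\<in>U. w x y) = (\<Sum>y\<in>U - A. w x y) + (\<Sum>y\<in>A. w x y)" for x
    using assms by (simp add: sum.subset_diff)
  then show ?thesis by (simp add: cut_size_def sum.distrib)
qed

lemma cut_size_singleton:
  assumes "finite U" "x \<in> U" "mgraph w"
  shows "cut_size U w {x} = (\<Sum>y\<in>U. w x y)"
  using assms by (simp add: cut_size_def sum.remove mgraph_def)

lemma mgraph_remove_edge:
  assumes "mgraph w" "0 < w p q" "p \<noteq> q"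
  shows "mgraph (\<lambda>x y. w x y - edge p q x y)"
  unfolding mgraph_def
proof (intro conjI allI)
  fix x y
  have s: "w q p = w p q" "w x y = w y x" "0 \<le> w x y" "w x x = 0"
    using assms by (auto simp: mgraph_def)
  show "0 \<le> w x y - edge p q x y" using assms s by (auto simp: edge_def)
  show "w x y - edge p q x y = w y x - edge p q y x" using s by (auto simp: edge_def)
  show "w x x - edge p q x x = 0" using s assms by (auto simp: edge_def)
qed

lemma orientsD:
  assumes "orients w f"
  shows "f y x = - f x y" "\<bar>f x y\<bar> \<le> w x y" "even (w x y - f x y)"
  using assms unfolding orients_def by blast+

lemma arc_antisym: "p \<noteq> q \<Longrightarrow> arc p q y x = - arc p q x y"
  by (auto simp: arc_def)

lemma abs_arc: "p \<noteq> q \<Longrightarrow> \<bar>arc p q x y\<bar> = edge p q x y"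
  by (auto simp: arc_def edge_def)

lemma even_edge_arc: "p \<noteq> q \<Longrightarrow> even (edge p q x y - arc p q x y)"
  by (auto simp: arc_def edge_def)

lemma orients_add_arc:
  assumes "orients (\<lambda>x y. w x y - edge p q x y) f" "p \<noteq> q"
  shows "orients w (\<lambda>x y. f x y + arc p q x y)"
  unfolding orients_def
proof (intro allI conjI)
  fix x y
  note o = orientsD[OF assms(1)]
  show "f y x + arc p q y x = - (f x y + arc p q x y)"
    using o(1)[of y x] arc_antisym[OF assms(2), of y x] by linarith
  show "\<bar>f x y + arc p q x y\<bar> \<le> w x y"
    using o(2)[of x y] abs_arc[OF assms(2), of x y] by linarith
  show "even (w x y - (f x y + arc p q x y))"
    using o(3)[of x y] even_edge_arc[OF assms(2), of x y] by presburger
qed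

text \<open>Takes one edge back out of an orientation together with a direction it may have. This
  serves to undo a lifting and to return from multiplicities to single arcs.\<close>

lemma orients_split_edge:
  assumes "orients (\<lambda>x y. w x y + edge p q x y) f" "0 \<le> w p q" "0 \<le> w q p" "p \<noteq> q"
  obtains "orients w (\<lambda>x y. f x y - arc p q x y)" | "orients w (\<lambda>x y. f x y + arc p q x y)"
proof -
  note o = orientsD[OF assms(1)]
  have pq: "\<bar>f p q\<bar> \<le> w p q + 1" "even (w p q + 1 - f p q)" "f q p = - f p q"
    "\<bar>f q p\<bar> \<le> w q p + 1" "even (w q p + 1 - f q p)"
    using o(2)[of p q] o(3)[of p q] o(2)[of q p] o(3)[of q p] o(1)[of q p]
    by (simp_all add: edge_def)
  \<comment> \<open>Removing an arc of the prevailing direction shrinks the imbalance. If the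
    imbalance is 0, parity leaves at least one further edge, so the bound survives as well.\<close>
  define s :: int where "s = (if 0 < f p q then - 1 else 1)"
  have *: "\<bar>f p q + s\<bar> \<le> w p q" "\<bar>f q p - s\<bar> \<le> w q p"
    using pq assms(2,3) unfolding s_def by presburger+
  have "orients w (\<lambda>x y. f x y + s * arc p q x y)"
    unfolding orients_def
  proof (intro allI conjI)
    fix x y
    show "f y x + s * arc p q y x = - (f x y + s * arc p q x y)"
      by (simp only: o(1)[of y x] arc_antisym[OF assms(4), of y x] mult_minus_right minus_add_distrib)
    show "\<bar>f x y + s * arc p q x y\<bar> \<le> w x y"
    proof (cases "edge p q x y = 0")
      case True
      then show ?thesis using o(2)[of x y] abs_arc[OF assms(4), of x y] by simp
    next
      case False
      then consider "x = p" "y = q" | "x = q" "y = p" by (auto simp: edge_def split: if_splits)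
      then show ?thesis using * assms(4) by cases (simp_all add: arc_def)
    qed
    show "even (w x y - (f x y + s * arc p q x y))"
      using o(3)[of x y] even_edge_arc[OF assms(4), of x y] unfolding s_def by presburger
  qed
  then show ?thesis
    using that unfolding s_def by (cases "0 < f p q") auto
qed

section \<open>Demands, prescribed arcs and the invariant of the induction\<close>

context half_modulus
begin

definition realizable :: "'v set \<Rightarrow> ('v \<Rightarrow> 'v \<Rightarrow> int) \<Rightarrow> ('v \<Rightarrow> int) \<Rightarrow> bool" where
  "realizable U w t \<longleftrightarrow> (\<exists>f. orients w f \<and> (\<forall>x\<in>U. 2 * m dvd (\<Sum>y\<in>U. f x y) - t x))"

text \<open>The special vertex is not in \<open>U\<close>. Its edges to \<open>x\<close> number \<open>c x\<close>, with \<open>n x\<close> the number directed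
  to \<open>x\<close> minus the number directed away from \<open>x\<close>; hence \<open>x\<close> must have net outdegree
  \<open>\<tau> x + n x\<close> modulo \<open>2m\<close> inside \<open>U\<close>.\<close>
definition balanced ::
  "'v set \<Rightarrow> ('v \<Rightarrow> 'v \<Rightarrow> int) \<Rightarrow> ('v \<Rightarrow> int) \<Rightarrow> ('v \<Rightarrow> int) \<Rightarrow> ('v \<Rightarrow> int) \<Rightarrow> bool" where
  "balanced U w c n \<tau> \<longleftrightarrow> finite U \<and> mgraph w \<and>
     (\<forall>x\<in>U. \<bar>n x\<bar> \<le> c x \<and> even (c x - n x) \<and> even (\<tau> x + n x + (\<Sum>y\<in>U. w x y))) \<and>
     2 * m dvd (\<Sum>x\<in>U. \<tau> x + n x)"

definition good :: "'v set \<Rightarrow> ('v \<Rightarrow> 'v \<Rightarrow> int) \<Rightarrow> ('v \<Rightarrow> int) \<Rightarrow> ('v \<Rightarrow> int) \<Rightarrow> 'v set \<Rightarrow> bool" where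
  "good U w c \<tau> A \<longleftrightarrow> 2 * m - 2 + nd (sum \<tau> A) \<le> deg U w c A"

text \<open>The special vertex has degree \<open>sum c U\<close> and net outdegree
  \<open>sum n U\<close>, which is \<open>- sum \<tau> U\<close> modulo \<open>2 * m\<close>; so its
  degree is bounded from above by the expression that bounds the other degrees from below. The
  exempt vertex \<open>v\<close> may lie outside \<open>U\<close>.\<close>

definition admissible ::
  "'v set \<Rightarrow> ('v \<Rightarrow> 'v \<Rightarrow> int) \<Rightarrow> ('v \<Rightarrow> int) \<Rightarrow> ('v \<Rightarrow> int) \<Rightarrow> ('v \<Rightarrow> int) \<Rightarrow> 'v \<Rightarrow> bool" where
  "admissible U w c n \<tau> v \<longleftrightarrow> balanced U w c n \<tau> \<and> 2 \<le> card U \<and>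
     sum c U \<le> 2 * m - 2 + nd (sum \<tau> U) \<and>
     (\<forall>A. A \<subseteq> U \<and> A \<noteq> {} \<and> A \<noteq> U \<longrightarrow> good U w c \<tau> A \<or> A = {v} \<and> 2 * m dvd \<tau> v)"

text \<open>Summing the vertex parities over \<open>A\<close> counts every edge inside
  \<open>A\<close> twice, and \<open>n\<close> agrees with \<open>c\<close> modulo 2.\<close>

lemma deg_parity:
  assumes "balanced U w c n \<tau>" "A \<subseteq> U"
  shows "even (deg U w c A + sum \<tau> A)"
proof -
  have fin: "finite U" "finite A" using assms finite_subset by (auto simp: balanced_def)
  have "even (\<Sum>x\<in>A. (\<tau> x + n x + (\<Sum>y\<in>U. w x y)) + (c x - n x))"
    using assms by (intro dvd_sum) (auto simp: balanced_def)
  also have "(\<Sum>x\<in>A. (\<tau> x + n x + (\<Sum>y\<in>U. w x y)) + (c x - n x))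
      = sum \<tau> A + sum c A + (\<Sum>x\<in>A. \<Sum>y\<in>U. w x y)"
    by (simp add: sum.distrib sum_subtractf)
  also have "\<dots> = deg U w c A + sum \<tau> A + (\<Sum>x\<in>A. \<Sum>y\<in>A. w x y)"
    using sum_degrees[OF fin(1) assms(2), of w] by (simp add: deg_def)
  finally show ?thesis
    using even_sum_symmetric[OF fin(2)] assms by (auto simp: balanced_def)
qed

text \<open>Degree and bound have the same parity, so a bound that is not attained is exceeded by at
  least 2.\<close>

lemma good_slack:
  assumes "balanced U w c n \<tau>" "A \<subseteq> U" "good U w c \<tau> A" "deg U w c A \<noteq> 2 * m - 2 + nd (sum \<tau> A)"
  shows "2 * m + nd (sum \<tau> A) \<le> deg U w c A"
proof -
  have "even (deg U w c A + nd (sum \<tau> A))"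
    using deg_parity[OF assms(1,2)] nd_parity[of "sum \<tau> A"] by simp
  then show ?thesis using assms(3,4) unfolding good_def by presburger
qed

text \<open>The edge \<open>pq\<close> is deleted after being directed from \<open>p\<close> to
  \<open>q\<close> if \<open>s = 1\<close>, and backwards if \<open>s = - 1\<close>. At
  \<open>p\<close> and \<open>q\<close>, \<open>a\<close> and \<open>b\<close> change the number of
  edges to the special vertex, \<open>a'\<close> and \<open>b'\<close> their net direction,
  \<open>e\<close> and \<open>g\<close> the demands; the targets \<open>\<tau> + n\<close> account
  for the deleted arc.\<close>

lemma balanced_step:
  assumes b: "balanced U w c n \<tau>"
    and pq: "p \<in> U" "q \<in> U" "p \<noteq> q" "0 < w p q"
    and s: "a' + e = - s" "b' + g = s" "\<bar>s\<bar> = 1"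
    and p: "\<bar>n p + a'\<bar> \<le> c p + a" "even (a - a')"
    and q: "\<bar>n q + b'\<bar> \<le> c q + b" "even (b - b')"
  shows "balanced U (\<lambda>x y. w x y - edge p q x y) (upd p q a b c) (upd p q a' b' n) (upd p q e g \<tau>)"
proof -
  have fin: "finite U" and w: "mgraph w" using b by (auto simp: balanced_def)
  have os: "odd s" using s(3) by (auto simp: abs_if split: if_splits)
  have vert: "\<bar>upd p q a' b' n x\<bar> \<le> upd p q a b c x \<and> even (upd p q a b c x - upd p q a' b' n x) \<and>
      even (upd p q e g \<tau> x + upd p q a' b' n x + (\<Sum>y\<in>U. w x y - edge p q x y))"
    if x: "x \<in> U" for x
  proof -
    have bx: "\<bar>n x\<bar> \<le> c x" "even (c x - n x)" "even (\<tau> x + n x + (\<Sum>y\<in>U. w x y))"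
      using b x by (auto simp: balanced_def)
    have S: "(\<Sum>y\<in>U. w x y - edge p q x y) = (\<Sum>y\<in>U. w x y) - (if x = p \<or> x = q then 1 else 0)"
      using fin pq by (simp add: sum_subtractf sum_edge)
    consider "x = p" | "x = q" | "x \<noteq> p" "x \<noteq> q" by blast
    then show ?thesis
    proof cases
      case 1
      then have "even (c p - n p)" "even (\<tau> p + n p + (\<Sum>y\<in>U. w p y))" using bx by auto
      then have "even (c p + a - (n p + a'))" "even (\<tau> p + e + (n p + a') + ((\<Sum>y\<in>U. w p y) - 1))"
        using p(2) s(1) os by presburger+
      then show ?thesis using 1 p pq unfolding S by (simp add: upd_def)
    next
      case 2
      then have "even (c q - n q)" "even (\<tau> q + n q + (\<Sum>y\<in>U. w q y))" using bx by auto
      then have "even (c q + b - (n q + b'))" "even (\<tau> q + g + (n q + b') + ((\<Sum>y\<in>U. w q y) - 1))"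
        using q(2) s(2) os by presburger+
      then show ?thesis using 2 q pq unfolding S by (simp add: upd_def)
    next
      case 3
      then show ?thesis using bx unfolding S by (auto simp: upd_def)
    qed
  qed
  have "(\<Sum>x\<in>U. upd p q e g \<tau> x + upd p q a' b' n x) = (\<Sum>x\<in>U. \<tau> x + n x) + (a' + e) + (b' + g)"
    using fin pq by (simp add: sum.distrib sum_upd)
  also have "\<dots> = (\<Sum>x\<in>U. \<tau> x + n x)" using s by simp
  finally show ?thesis
    using b vert mgraph_remove_edge[OF w pq(4,3)] by (simp add: balanced_def)
qed

lemma realizable_step:
  assumes fin: "finite U" and pq: "p \<in> U" "q \<in> U" "p \<noteq> q"
    and s: "a' + e = - s" "b' + g = s" "\<bar>s\<bar> = 1"
    and r: "realizable U (\<lambda>x y. w x y - edge p q x y) (\<lambda>x. upd p q e g \<tau> x + upd p q a' b' n x)"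
  shows "realizable U w (\<lambda>x. \<tau> x + n x)"
proof -
  obtain f where f: "orients (\<lambda>x y. w x y - edge p q x y) f"
    "\<And>x. x \<in> U \<Longrightarrow> 2 * m dvd (\<Sum>y\<in>U. f x y) - (upd p q e g \<tau> x + upd p q a' b' n x)"
    using r unfolding realizable_def by blast
  define F where "F = (\<lambda>x y. f x y + (if s = 1 then arc p q x y else arc q p x y))"
  have "orients w F"
  proof (cases "s = 1")
    case True
    then show ?thesis using orients_add_arc[OF f(1) pq(3)] by (simp add: F_def)
  next
    case False
    have e: "edge q p = edge p q" by (auto simp: edge_def fun_eq_iff)
    show ?thesis using orients_add_arc[of w q p f] f(1) pq(3) False by (simp add: F_def e)
  qed
  moreover have "2 * m dvd (\<Sum>y\<in>U. F x y) - (\<tau> x + n x)" if x: "x \<in> U" for x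
  proof -
    have "(\<Sum>y\<in>U. F x y) = (\<Sum>y\<in>U. f x y) + (if x = p then s else 0) + (if x = q then - s else 0)"
      using fin pq s(3) by (auto simp: F_def sum.distrib sum_arc abs_if split: if_splits)
    then have "(\<Sum>y\<in>U. F x y) - (\<tau> x + n x)
        = (\<Sum>y\<in>U. f x y) - (upd p q e g \<tau> x + upd p q a' b' n x)"
      using s pq(3) by (auto simp: upd_def)
    then show ?thesis using f(2)[OF x] by simp
  qed
  ultimately show ?thesis unfolding realizable_def by blast
qed

lemma deg_step:
  assumes "finite U" "A \<subseteq> U" "p \<in> U" "q \<in> U" "p \<noteq> q"
  shows "deg U (\<lambda>x y. w x y - edge p q x y) (upd p q a b c) A
    = deg U w c A + (if p \<in> A then a else 0) + (if q \<in> A then b else 0)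
      - (if (p \<in> A) = (q \<in> A) then 0 else 1)"
  using assms finite_subset[OF assms(2,1)] by (simp add: deg_def cut_size_diff cut_size_edge sum_upd)

end

subsection \<open>Reductions at a single edge\<close>

lemma orients_diag: "orients w f \<Longrightarrow> f x x = 0"
  using orientsD(1)[of w f x x] by linarith

lemma orients_exists:
  assumes "mgraph w"
  shows "\<exists>g. orients w g"
proof -
  \<comment> \<open>The choice depends only on the set \<open>{x, y}\<close>, hence gives the same
    end in both orders; all parallel edges are directed away from it.\<close>
  define top where "top = (\<lambda>x y :: 'a. SOME z. z \<in> {x, y})"
  have "top x y \<in> {x, y}" for x y
    unfolding top_def by (rule someI[of _ x]) simp
  then have t: "top x y = x \<or> top x y = y" for x y
    by blast
  have comm: "top y x = top x y" for x y
    unfolding top_def insert_commute[of y x] ..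
  define g where "g = (\<lambda>x y. if x = y then 0 else if top x y = x then w x y else - w x y)"
  have w: "0 \<le> w x y" "w x y = w y x" "w x x = 0" for x y
    using assms by (auto simp: mgraph_def)
  have "g y x = - g x y \<and> \<bar>g x y\<bar> \<le> w x y \<and> even (w x y - g x y)" for x y
  proof (cases "x = y")
    case True
    then show ?thesis by (simp add: g_def w(3))
  next
    case False
    then show ?thesis using t[of x y] w(1)[of x y] w(2)[of y x] by (simp add: g_def comm[of y x]) auto
  qed
  then show ?thesis unfolding orients_def by blast
qed

lemma orients_set:
  assumes g: "orients w g" and w: "mgraph w" and xy: "x \<noteq> y"
    and r: "\<bar>r\<bar> \<le> w x y" "even (w x y - r)"
  shows "orients w (\<lambda>p q. g p q + (r - g x y) * arc x y p q)"
  unfolding orients_def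
proof (intro allI conjI)
  define f where "f = (\<lambda>p q. g p q + (r - g x y) * arc x y p q)"
  fix p q
  show "g q p + (r - g x y) * arc x y q p = - (g p q + (r - g x y) * arc x y p q)"
    by (simp only: orientsD(1)[OF g, of q p] arc_antisym[OF xy, of q p] mult_minus_right
        minus_add_distrib)
  have wyx: "w y x = w x y" using w by (simp add: mgraph_def)
  have "\<bar>f p q\<bar> \<le> w p q \<and> even (w p q - f p q)"
  proof (cases "arc x y p q = 0")
    case True
    then show ?thesis using orientsD(2,3)[OF g, of p q] by (simp add: f_def)
  next
    case False
    then consider "p = x" "q = y" | "p = y" "q = x" by (auto simp: arc_def split: if_splits)
    then show ?thesis
      using r wyx xy orientsD(1)[OF g, of y x] by cases (simp_all add: f_def arc_def)
  qed
  then show "\<bar>g p q + (r - g x y) * arc x y p q\<bar> \<le> w p q"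
    "even (w p q - (g p q + (r - g x y) * arc x y p q))"
    by (auto simp: f_def)
qed

section \<open>The induction order and cut inequalities\<close>

context half_modulus
begin

definition total :: "'v set \<Rightarrow> ('v \<Rightarrow> 'v \<Rightarrow> int) \<Rightarrow> int" where
  "total U w = (\<Sum>x\<in>U. \<Sum>y\<in>U. w x y)"

text \<open>Lexicographic in vertices, edges inside \<open>U\<close> and edges at the special
  vertex. The last come last because deleting an edge inside \<open>U\<close> may create new ones at
  the special vertex.\<close>

definition smaller ::
  "'v set \<Rightarrow> ('v \<Rightarrow> 'v \<Rightarrow> int) \<Rightarrow> ('v \<Rightarrow> int) \<Rightarrow> 'v set \<Rightarrow> ('v \<Rightarrow> 'v \<Rightarrow> int) \<Rightarrow> ('v \<Rightarrow> int) \<Rightarrow> bool" where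
  "smaller U' w' c' U w c \<longleftrightarrow> card U' < card U \<or>
     card U' = card U \<and> (total U' w' < total U w \<or> total U' w' = total U w \<and> sum c' U' < sum c U)"

text \<open>Serves as the induction hypothesis of all reduction steps.\<close>

definition reduces :: "'v set \<Rightarrow> ('v \<Rightarrow> 'v \<Rightarrow> int) \<Rightarrow> ('v \<Rightarrow> int) \<Rightarrow> bool" where
  "reduces U w c \<longleftrightarrow> (\<forall>U' w' c' n' \<tau>' v'. admissible U' w' c' n' \<tau>' v' \<longrightarrow> smaller U' w' c' U w c \<longrightarrow>
     realizable U' w' (\<lambda>x. \<tau>' x + n' x))"

definition slack :: "'v set \<Rightarrow> ('v \<Rightarrow> 'v \<Rightarrow> int) \<Rightarrow> ('v \<Rightarrow> int) \<Rightarrow> ('v \<Rightarrow> int) \<Rightarrow> bool" where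
  "slack U w c \<tau> \<longleftrightarrow>
     (\<forall>A. A \<subseteq> U \<and> 2 \<le> card A \<and> A \<noteq> U \<longrightarrow> 2 * m + nd (sum \<tau> A) \<le> deg U w c A)"

lemma admissibleD:
  assumes "admissible U w c n \<tau> v"
  shows "balanced U w c n \<tau>" "2 \<le> card U" "sum c U \<le> 2 * m - 2 + nd (sum \<tau> U)" "finite U" "mgraph w"
    "\<And>x. x \<in> U \<Longrightarrow> \<bar>n x\<bar> \<le> c x" "\<And>x. x \<in> U \<Longrightarrow> 0 \<le> c x" "\<And>x. x \<in> U \<Longrightarrow> even (c x - n x)"
    "2 * m dvd (\<Sum>x\<in>U. \<tau> x + n x)"
proof -
  show b: "balanced U w c n \<tau>" and "2 \<le> card U" "sum c U \<le> 2 * m - 2 + nd (sum \<tau> U)"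
    using assms by (auto simp: admissible_def)
  show "finite U" "mgraph w" "2 * m dvd (\<Sum>x\<in>U. \<tau> x + n x)"
    using b by (auto simp: balanced_def)
  show "\<bar>n x\<bar> \<le> c x" "even (c x - n x)" if "x \<in> U" for x
    using b that by (auto simp: balanced_def)
  then show "0 \<le> c x" if "x \<in> U" for x
    using that by force
qed

lemma admissible_good:
  assumes "admissible U w c n \<tau> v" "A \<subseteq> U" "A \<noteq> {}" "A \<noteq> U"
  shows "2 * m - 2 + nd (sum \<tau> A) \<le> deg U w c A \<or> A = {v} \<and> 2 * m dvd \<tau> v"
  using assms unfolding admissible_def good_def by blast

lemma deg_split:
  assumes "finite U" "mgraph w" "A \<subseteq> U"
  shows "deg U w c A + deg U w c (U - A) = 2 * cut_size U w A + sum c U"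
proof -
  have "sum c A + sum c (U - A) = sum c U"
    using assms by (metis add.commute sum.subset_diff)
  then show ?thesis using cut_size_commute[OF assms(2,3)] by (simp add: deg_def)
qed

text \<open>The degrees of \<open>A\<close> and \<open>U - A\<close> together count the cut twice
  and the edges at the special vertex once. By the triangle inequality for \<open>nd\<close>, the
  upper bound on the latter cancels one of the two lower bounds \<open>2 * m - 2\<close> and all
  distances.\<close>

lemma cut_lower_bound:
  assumes i: "admissible U w c n \<tau> v" and A: "A \<subseteq> U"
    and g: "2 * m - 2 + nd (sum \<tau> A) \<le> deg U w c A"
      "2 * m - 2 + nd (sum \<tau> (U - A)) \<le> deg U w c (U - A)"
  shows "m - 1 \<le> cut_size U w A"
proof -
  note d = admissibleD[OF i]
  have "sum \<tau> U = sum \<tau> (U - A) + sum \<tau> A"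
    using d(4) A by (simp add: sum.subset_diff)
  then have "nd (sum \<tau> U) \<le> nd (sum \<tau> (U - A)) + nd (sum \<tau> A)"
    using nd_triangle by simp
  then show ?thesis
    using deg_split[OF d(4,5) A, of c] g d(3) by linarith
qed

text \<open>Since \<open>\<tau> x\<close> vanishes modulo \<open>2 * m\<close>, the set
  \<open>U - {x}\<close> has the same demand distance as \<open>U\<close>. Its degree is therefore
  at least that of the special vertex, and the edges common to both cancel.\<close>

lemma exceptional_cut:
  assumes i: "admissible U w c n \<tau> v" and x: "x \<in> U" "2 * m dvd \<tau> x"
    and g: "2 * m - 2 + nd (sum \<tau> (U - {x})) \<le> deg U w c (U - {x})"
  shows "c x \<le> cut_size U w {x}"
proof -
  note d = admissibleD[OF i]
  have "nd (sum \<tau> U) = nd (sum \<tau> (U - {x}))"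
    using d(4) x by (intro nd_cong) (simp add: sum.remove)
  then show ?thesis
    using deg_split[OF d(4,5), of "{x}" c] x g d(3) by (simp add: deg_def)
qed

lemma realize_two:
  assumes U: "U = {x, y}" "x \<noteq> y" and w: "mgraph w"
    and r: "\<bar>r\<bar> \<le> w x y" "even (w x y - r)" "2 * m dvd r - t x" "2 * m dvd t x + t y"
  shows "realizable U w t"
proof -
  obtain g where g: "orients w g" using orients_exists[OF w] by blast
  define f where "f = (\<lambda>p q. g p q + (r - g x y) * arc x y p q)"
  have f: "f x y = r" "f y x = - r" "f x x = 0" "f y y = 0"
    using U(2) orientsD(1)[OF g, of y x] by (simp_all add: f_def arc_def orients_diag[OF g])
  have "orients w f"
    unfolding f_def using g w U(2) r(1,2) by (rule orients_set)
  moreover have "2 * m dvd (\<Sum>q\<in>U. f p q) - t p" if "p \<in> U" for p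
  proof -
    have "2 * m dvd - r - t y"
      using dvd_add[OF r(3,4)] dvd_minus_iff[of "2 * m" "r + t y"] by (simp add: algebra_simps)
    then show ?thesis using that U f r(3) by auto
  qed
  ultimately show ?thesis unfolding realizable_def by blast
qed

lemma base_case:
  assumes i: "admissible U w c n \<tau> v" and U: "card U = 2"
  shows "realizable U w (\<lambda>x. \<tau> x + n x)"
proof -
  note d = admissibleD[OF i]
  obtain x y where xy: "U = {x, y}" "x \<noteq> y" using U by (auto simp: card_2_iff)
  have cutxy: "cut_size U w {x} = w x y" "cut_size U w {y} = w x y"
    using xy d(5) by (auto simp: cut_size_def mgraph_def insert_Diff_if)
  have par: "even (\<tau> p + n p + w x y)" if "p \<in> U" for p
    using d(1) that xy d(5) by (auto simp: balanced_def mgraph_def)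
  have tot: "2 * m dvd (\<tau> x + n x) + (\<tau> y + n y)"
    using d(9) xy by simp
  \<comment> \<open>A vertex \<open>p\<close> of demand 0 only has to pass on the imbalance
    \<open>n p\<close> of its arcs at the special vertex, and \<open>exceptional_cut\<close>
    supplies enough edges to \<open>q\<close>.\<close>
  have exc: "realizable {p, q} w (\<lambda>x. \<tau> x + n x)"
    if pq: "U = {p, q}" "p \<noteq> q" and z: "2 * m dvd \<tau> p"
      and g: "2 * m - 2 + nd (sum \<tau> {q}) \<le> deg U w c {q}" for p q
  proof (rule realize_two[OF refl pq(2) d(5), where r = "n p"])
    have "U - {p} = {q}" using pq by auto
    then have "c p \<le> cut_size U w {p}"
      using exceptional_cut[OF i, of p] pq z g by auto
    moreover have "cut_size U w {p} = w p q" using pq by (auto simp: cut_size_def insert_Diff_if)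
    ultimately show "\<bar>n p\<bar> \<le> w p q" using d(6)[of p] pq by simp
    have "even (\<tau> p + n p + w p q)"
      using d(1) pq d(5) by (auto simp: balanced_def mgraph_def)
    moreover have "even (\<tau> p)" using z by (metis dvd_mult_left)
    ultimately show "even (w p q - n p)" by presburger
    show "2 * m dvd n p - (\<tau> p + n p)" using z by simp
    show "2 * m dvd \<tau> p + n p + (\<tau> q + n q)"
      using d(9) pq by simp
  qed
  have ne: "{x} \<noteq> U" "{y} \<noteq> U" "{x} \<subseteq> U" "{y} \<subseteq> U" using xy by auto
  \<comment> \<open>At most one of the two vertices is exempt.\<close>
  consider "2 * m dvd \<tau> x" "2 * m - 2 + nd (sum \<tau> {y}) \<le> deg U w c {y}"
    | "2 * m dvd \<tau> y" "2 * m - 2 + nd (sum \<tau> {x}) \<le> deg U w c {x}"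
    | "2 * m - 2 + nd (sum \<tau> {x}) \<le> deg U w c {x}" "2 * m - 2 + nd (sum \<tau> {y}) \<le> deg U w c {y}"
    using admissible_good[OF i ne(3) _ ne(1)] admissible_good[OF i ne(4) _ ne(2)] xy(2) by auto
  then show ?thesis
  proof cases
    case 1
    then show ?thesis using exc[of x y] xy by simp
  next
    case 2
    then show ?thesis using exc[of y x] xy by (simp add: insert_commute)
  next
    case 3
    have "U - {x} = {y}" using xy by auto
    then have lb: "m - 1 \<le> w x y"
      using cut_lower_bound[OF i ne(3)] 3 cutxy by simp
    obtain r where r: "2 * m dvd (\<tau> x + n x) - r" "\<bar>r\<bar> \<le> m"
      using nd_rep by blast
    have ev: "even (w x y - r)"
    proof -
      have "even ((\<tau> x + n x) - r)" using r(1) by (metis dvd_mult_left)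
      moreover have "even (\<tau> x + n x + w x y)" using par[of x] xy by simp
      ultimately show ?thesis by presburger
    qed
    \<comment> \<open>The inequality could fail only with \<open>w x y = m - 1\<close> and
      \<open>r\<close> of absolute value \<open>m\<close>, and these differ in parity.\<close>
    have "\<bar>r\<bar> \<le> w x y" using lb r(2) ev by presburger
    then show ?thesis
      using realize_two[OF xy d(5), of r "\<lambda>x. \<tau> x + n x"] r(1) ev tot
        dvd_diff_commute[of "2 * m" "\<tau> x + n x" r] by blast
  qed
qed

section \<open>Deleting an edge inside \<open>U\<close> or at the special vertex\<close>

lemma total_edge:
  assumes "finite U" "p \<in> U" "q \<in> U" "p \<noteq> q"
  shows "total U (edge p q) = 2"
proof -
  have "total U (edge p q) = (\<Sum>x\<in>U. (if x = p then 1 else 0) + (if x = q then 1 else 0))"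
    unfolding total_def using assms by (intro sum.cong) (auto simp: sum_edge)
  then show ?thesis using assms by (simp add: sum.distrib)
qed

lemma total_diff: "total U (\<lambda>x y. w x y - u x y) = total U w - total U u"
  by (simp add: total_def sum_subtractf)

lemma total_add: "total U (\<lambda>x y. w x y + u x y) = total U w + total U u"
  by (simp add: total_def sum.distrib)

text \<open>Slack 2 lets every set of at least two vertices absorb changes within the limits
  \<open>big\<close>. Hence only the special vertex (\<open>total\<close>) and the two ends
  (\<open>sp\<close>, \<open>sq\<close>) need conditions of their own.\<close>

lemma edge_step:
  assumes i: "admissible U w c n \<tau> v" and sl: "slack U w c \<tau>" and red: "reduces U w c"
    and pq: "p \<in> U" "q \<in> U" "p \<noteq> q" "0 < w p q"
    and s: "a' + e = - s" "b' + g = s" "\<bar>s\<bar> = 1"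
    and p: "\<bar>n p + a'\<bar> \<le> c p + a" "even (a - a')"
    and q: "\<bar>n q + b'\<bar> \<le> c q + b" "even (b - b')"
    and total: "sum c U + a + b \<le> 2 * m - 2 + nd (sum \<tau> U + e + g)"
    and big: "\<bar>e\<bar> \<le> a + 1" "\<bar>g\<bar> \<le> b + 1" "\<bar>e + g\<bar> \<le> a + b + 2"
    and sp: "2 * m - 2 + nd (\<tau> p + e) \<le> deg U w c {p} + a - 1 \<or> p = v \<and> 2 * m dvd \<tau> p + e"
    and sq: "2 * m - 2 + nd (\<tau> q + g) \<le> deg U w c {q} + b - 1 \<or> q = v \<and> 2 * m dvd \<tau> q + g"
  shows "realizable U w (\<lambda>x. \<tau> x + n x)"
proof -
  note d = admissibleD[OF i]
  let ?w = "\<lambda>x y. w x y - edge p q x y" and ?c = "upd p q a b c" and ?n = "upd p q a' b' n"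
    and ?t = "upd p q e g \<tau>"
  have sums: "sum ?t A = sum \<tau> A + (if p \<in> A then e else 0) + (if q \<in> A then g else 0)" if "A \<subseteq> U" for A
    using that d(4) finite_subset by (intro sum_upd) blast
  have "2 * m - 2 + nd (sum ?t A) \<le> deg U ?w ?c A \<or> A = {v} \<and> 2 * m dvd ?t v"
    if A: "A \<subseteq> U" "A \<noteq> {}" "A \<noteq> U" for A
  proof (cases "2 \<le> card A")
    case True
    then have *: "2 * m + nd (sum \<tau> A) \<le> deg U w c A"
      using sl A by (simp add: slack_def)
    show ?thesis
      using * big nd_add_le[of "sum \<tau> A" e] nd_add_le[of "sum \<tau> A" g] nd_add_le[of "sum \<tau> A" "e + g"]
      unfolding deg_step[OF d(4) A(1) pq(1,2,3)] sums[OF A(1)]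
      by (auto simp: add.assoc)
  next
    case False
    moreover have "0 < card A" using A d(4) finite_subset by (auto simp: card_gt_0_iff)
    ultimately have "card A = 1" by linarith
    then obtain x where x: "A = {x}" by (auto simp: card_1_singleton_iff)
    consider "x = p" | "x = q" | "x \<noteq> p" "x \<noteq> q" by blast
    then show ?thesis
    proof cases
      case 1
      then show ?thesis using sp pq(3) x unfolding deg_step[OF d(4) A(1) pq(1,2,3)] sums[OF A(1)]
        by (auto simp: upd_def)
    next
      case 2
      then show ?thesis using sq pq(3) x unfolding deg_step[OF d(4) A(1) pq(1,2,3)] sums[OF A(1)]
        by (auto simp: upd_def)
    next
      case 3
      then show ?thesis using admissible_good[OF i A] x unfolding deg_step[OF d(4) A(1) pq(1,2,3)] sums[OF A(1)]
        by (auto simp: upd_def)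
    qed
  qed
  then have "admissible U ?w ?c ?n ?t v"
    using balanced_step[OF d(1) pq s p q] d(2) total pq sums[of U] sum_upd[OF d(4), of p q a b c]
    unfolding admissible_def good_def by simp
  moreover have "smaller U ?w ?c U w c"
    using total_edge[OF d(4) pq(1,2,3)] by (simp add: smaller_def total_diff)
  ultimately have "realizable U ?w (\<lambda>x. ?t x + ?n x)"
    using red unfolding reduces_def by blast
  then show ?thesis by (rule realizable_step[OF d(4) pq(1,2,3) s])
qed

text \<open>\<open>n x < c x\<close> means that some edge is directed from \<open>x\<close> to the
  special vertex. Deleting it lowers the degree of \<open>x\<close> by 1 and, the demand being
  positive, its bound too, while the target \<open>\<tau> x + n x\<close> stays the same.\<close>

lemma special_edge_step:
  assumes i: "admissible U w c n \<tau> v" and sl: "slack U w c \<tau>" and red: "reduces U w c"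
    and x: "x \<in> U" "pos (\<tau> x)" "n x < c x"
    and g: "2 * m - 2 + nd (\<tau> x) \<le> deg U w c {x}"
  shows "realizable U w (\<lambda>x. \<tau> x + n x)"
proof -
  note d = admissibleD[OF i]
  let ?c = "upd x x (- 1) 0 c" and ?n = "upd x x 1 0 n" and ?t = "upd x x (- 1) 0 \<tau>"
  have sums: "sum (upd x x a 0 h) A = sum h A + (if x \<in> A then a else 0)" if "A \<subseteq> U" for A a and h :: "'a \<Rightarrow> int"
    using sum_upd[OF finite_subset[OF that d(4)], of x x a 0 h] by simp
  have cx: "\<bar>n x + 1\<bar> \<le> c x - 1" "even (c x - n x)"
    using d(6,8)[OF x(1)] x(3) by presburger+
  have same: "?t y + ?n y = \<tau> y + n y" for y by (simp add: upd_def)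
  have b: "balanced U w ?c ?n ?t"
    using d(1) cx unfolding balanced_def same by (auto simp: upd_def)
  have "2 * m - 2 + nd (sum ?t A) \<le> deg U w ?c A \<or> A = {v} \<and> 2 * m dvd ?t v"
    if A: "A \<subseteq> U" "A \<noteq> {}" "A \<noteq> U" for A
  proof -
    have D: "deg U w ?c A = deg U w c A - (if x \<in> A then 1 else 0)"
      by (simp add: deg_def sums[OF A(1)])
    show ?thesis
    proof (cases "x \<in> A")
      case False
      then show ?thesis using admissible_good[OF i A] unfolding D sums[OF A(1)] by (auto simp: upd_def)
    next
      case True
      have "2 \<le> card A \<or> A = {x}"
      proof -
        have "finite A" using A d(4) finite_subset by blast
        then have "0 < card A" using A(2) by (simp add: card_gt_0_iff)
        then have "2 \<le> card A \<or> card A = 1" by linarith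
        then show ?thesis using True by (auto simp: card_1_singleton_iff)
      qed
      then show ?thesis
      proof
        assume "2 \<le> card A"
        then have "2 * m + nd (sum \<tau> A) \<le> deg U w c A"
          using sl A by (simp add: slack_def)
        then show ?thesis
          using nd_add_le[of "sum \<tau> A" "- 1"] True unfolding D sums[OF A(1)] by simp
      next
        assume "A = {x}"
        then show ?thesis using g pos_nd_diff_1[OF x(2)] unfolding D sums[OF A(1)] by simp
      qed
    qed
  qed
  moreover have "sum ?c U \<le> 2 * m - 2 + nd (sum ?t U)"
    using d(3) x(1) nd_add_le[of "sum \<tau> U - 1" 1] sums[of U] by simp
  ultimately have "admissible U w ?c ?n ?t v"
    using b d(2) by (simp add: admissible_def good_def)
  moreover have "smaller U w ?c U w c"
    using sums[of U "- 1" c] x(1) by (simp add: smaller_def)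
  ultimately have "realizable U w (\<lambda>x. ?t x + ?n x)"
    using red unfolding reduces_def by blast
  then show ?thesis by (simp only: same)
qed

end

subsection \<open>Vertices with zero demand\<close>

lemma edge_commute: "edge p q = edge q p"
  by (auto simp: edge_def fun_eq_iff)

context half_modulus
begin

text \<open>An edge from \<open>v\<close> to the special vertex and an edge from \<open>v\<close> to
  a neighbour \<open>y\<close> are merged into an edge from \<open>y\<close> to the special vertex,
  with all demands kept. Such a \<open>y\<close> exists because \<open>v\<close> has at least
  \<open>c v\<close> edges inside \<open>U\<close>.\<close>

lemma lift_through_special:
  assumes i: "admissible U w c n \<tau> v" and sl: "slack U w c \<tau>" and red: "reduces U w c"
    and v: "v \<in> U" "2 * m dvd \<tau> v" "0 < c v" and card: "3 \<le> card U"
  shows "realizable U w (\<lambda>x. \<tau> x + n x)"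
proof -
  note d = admissibleD[OF i]
  have "card (U - {v}) = card U - 1" using v(1) by simp
  then have "2 \<le> card (U - {v})" using card by linarith
  then have "2 * m + nd (sum \<tau> (U - {v})) \<le> deg U w c (U - {v})"
    using sl v(1) unfolding slack_def by blast
  then have "c v \<le> cut_size U w {v}"
    using exceptional_cut[OF i v(1,2)] by simp
  then have "0 < (\<Sum>y\<in>U. w v y)"
    using v(3) cut_size_singleton[OF d(4) v(1) d(5)] by simp
  then obtain y where y: "y \<in> U" "0 < w v y"
    using sum_nonpos[of U "w v"] by (meson not_le)
  have vy: "v \<noteq> y" using y d(5) by (auto simp: mgraph_def)
  have gy: "2 * m - 2 + nd (\<tau> y) \<le> deg U w c {y}"
    using admissible_good[OF i, of "{y}"] y vy v(1) by auto
  \<comment> \<open>If some arc enters \<open>v\<close> from the special vertex, it is continued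
    from \<open>v\<close> to \<open>y\<close>; otherwise all arcs leave \<open>v\<close> for the
    special vertex and the path is reversed.\<close>
  define s :: int where "s = (if - c v < n v then 1 else - 1)"
  have nv: "\<bar>n v\<bar> \<le> c v" "even (c v - n v)" using d(6,8) v(1) by auto
  show ?thesis
  proof (rule edge_step[OF i sl red v(1) y(1) vy y(2), where s = s and a = "- 1" and a' = "- s"
        and e = 0 and b = 1 and b' = s and g = 0])
    show "\<bar>n v + - s\<bar> \<le> c v + - 1"
      using nv v(3) unfolding s_def by presburger
    show "\<bar>n y + s\<bar> \<le> c y + 1"
      using d(6)[OF y(1)] by (auto simp: s_def)
  qed (use v gy d(3) in \<open>auto simp: s_def\<close>)
qed

text \<open>The path \<open>a\<close>, \<open>v\<close>, \<open>b\<close> is replaced by an edge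
  \<open>ab\<close>. A degree changes only if the set separates \<open>v\<close> from both
  \<open>a\<close> and \<open>b\<close>, and then it drops by 2: such a set is \<open>{v}\<close>,
  which is exempt, or has slack.\<close>

lemma lift_inside:
  assumes i: "admissible U w c n \<tau> v" and sl: "slack U w c \<tau>" and red: "reduces U w c"
    and v: "v \<in> U" "2 * m dvd \<tau> v"
    and ab: "a \<in> U" "b \<in> U" "a \<noteq> b" "0 < w v a" "0 < w v b"
  shows "realizable U w (\<lambda>x. \<tau> x + n x)"
proof -
  note d = admissibleD[OF i]
  have w: "0 \<le> w x y" "w x y = w y x" "w x x = 0" for x y
    using d(5) by (auto simp: mgraph_def)
  have va: "v \<noteq> a" "v \<noteq> b" using ab w(3) by auto
  define w1 where "w1 = (\<lambda>x y. w x y - edge v a x y)"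
  define w2 where "w2 = (\<lambda>x y. w1 x y - edge v b x y)"
  define w3 where "w3 = (\<lambda>x y. w2 x y + edge a b x y)"
  have g1: "mgraph w1" unfolding w1_def by (rule mgraph_remove_edge[OF d(5) ab(4) va(1)])
  have "0 < w1 v b" using ab va by (simp add: w1_def edge_def)
  then have g2: "mgraph w2" unfolding w2_def by (rule mgraph_remove_edge[OF g1 _ va(2)])
  have g3: "mgraph w3"
    using g2 ab(3) by (auto simp: w3_def mgraph_def edge_def)
  have cut3: "cut_size U w3 A = cut_size U w A - (if (v \<in> A) = (a \<in> A) then 0 else 1)
      - (if (v \<in> A) = (b \<in> A) then 0 else 1) + (if (a \<in> A) = (b \<in> A) then 0 else 1)"
    if "A \<subseteq> U" for A
    using that d(4) v(1) ab va unfolding w3_def w2_def w1_def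
    by (simp add: cut_size_add cut_size_diff cut_size_edge)
  have row: "even (\<Sum>y\<in>U. w3 x y) \<longleftrightarrow> even (\<Sum>y\<in>U. w x y)" if "x \<in> U" for x
  proof -
    have "(\<Sum>y\<in>U. w3 x y) = (\<Sum>y\<in>U. w x y) - (if x = v then 2 else 0)"
      using d(4) v(1) ab va unfolding w3_def w2_def w1_def
      by (simp add: sum.distrib sum_subtractf sum_edge)
    then show ?thesis by simp
  qed
  have b3: "balanced U w3 c n \<tau>"
    using d(1) g3 row unfolding balanced_def by auto
  have "2 * m - 2 + nd (sum \<tau> A) \<le> deg U w3 c A \<or> A = {v} \<and> 2 * m dvd \<tau> v"
    if A: "A \<subseteq> U" "A \<noteq> {}" "A \<noteq> U" for A
  proof (cases "2 \<le> card A")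
    case True
    then have "2 * m + nd (sum \<tau> A) \<le> deg U w c A" using sl A by (simp add: slack_def)
    then show ?thesis using cut3[OF A(1)] by (auto simp: deg_def)
  next
    case False
    moreover have "0 < card A" using A d(4) finite_subset by (auto simp: card_gt_0_iff)
    ultimately have "card A = 1" by linarith
    then obtain x where x: "A = {x}" by (auto simp: card_1_singleton_iff)
    show ?thesis using admissible_good[OF i A] cut3[OF A(1)] x va ab(3) v(2) by (auto simp: deg_def)
  qed
  then have "admissible U w3 c n \<tau> v"
    using b3 d(2,3) by (simp add: admissible_def good_def)
  moreover have "smaller U w3 c U w c"
    using total_edge[OF d(4)] v(1) ab va
    by (simp add: smaller_def w3_def w2_def w1_def total_add total_diff)
  ultimately have "realizable U w3 (\<lambda>x. \<tau> x + n x)"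
    using red unfolding reduces_def by blast
  then obtain f where f: "orients w3 f" "\<And>x. x \<in> U \<Longrightarrow> 2 * m dvd (\<Sum>y\<in>U. f x y) - (\<tau> x + n x)"
    unfolding realizable_def by blast
  have w2nn: "0 \<le> w2 a b" "0 \<le> w2 b a" using g2 by (auto simp: mgraph_def)
  \<comment> \<open>The direction found for the edge \<open>ab\<close> is passed on to the path
    through \<open>v\<close>, which leaves every net outdegree unchanged.\<close>
  obtain F where F: "orients w F" "\<And>x. x \<in> U \<Longrightarrow> (\<Sum>y\<in>U. F x y) = (\<Sum>y\<in>U. f x y)"
  proof (rule orients_split_edge[OF f(1)[unfolded w3_def] w2nn ab(3)])
    assume "orients w2 (\<lambda>x y. f x y - arc a b x y)"
    then have "orients w1 (\<lambda>x y. f x y - arc a b x y + arc v b x y)"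
      unfolding w2_def by (rule orients_add_arc[OF _ va(2)])
    then have "orients w (\<lambda>x y. f x y - arc a b x y + arc v b x y + arc a v x y)"
      unfolding w1_def edge_commute[of v a] by (rule orients_add_arc) (use va in simp)
    then show thesis
    proof (rule that)
      show "(\<Sum>y\<in>U. f x y - arc a b x y + arc v b x y + arc a v x y) = (\<Sum>y\<in>U. f x y)" for x
        using d(4) v(1) ab va by (simp add: sum.distrib sum_subtractf sum_arc)
    qed
  next
    assume "orients w2 (\<lambda>x y. f x y + arc a b x y)"
    then have "orients w1 (\<lambda>x y. f x y + arc a b x y + arc b v x y)"
      unfolding w2_def edge_commute[of v b] by (rule orients_add_arc) (use va in simp)
    then have "orients w (\<lambda>x y. f x y + arc a b x y + arc b v x y + arc v a x y)"
      unfolding w1_def by (rule orients_add_arc[OF _ va(1)])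
    then show thesis
    proof (rule that)
      show "(\<Sum>y\<in>U. f x y + arc a b x y + arc b v x y + arc v a x y) = (\<Sum>y\<in>U. f x y)" for x
        using d(4) v(1) ab va by (simp add: sum.distrib sum_arc)
    qed
  qed
  then show ?thesis using f(2) unfolding realizable_def by metis
qed

text \<open>Here \<open>v\<close> has no neighbour except possibly \<open>b\<close>, and by parity
  an even number of edges to it, which may be split equally between the two directions. For the
  bounds without \<open>v\<close>, a set containing \<open>b\<close> is compared with its union with
  \<open>{v}\<close>, any other set with itself.\<close>

lemma drop_vertex:
  assumes i: "admissible U w c n \<tau> v" and red: "reduces U w c"
    and v: "v \<in> U" "2 * m dvd \<tau> v" "c v = 0" and card: "3 \<le> card U"
    and b: "b \<in> U" "b \<noteq> v" "\<And>x. x \<in> U \<Longrightarrow> x \<noteq> b \<Longrightarrow> w v x = 0"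
  shows "realizable U w (\<lambda>x. \<tau> x + n x)"
proof -
  note d = admissibleD[OF i]
  have w: "0 \<le> w x y" "w x y = w y x" "w x x = 0" for x y
    using d(5) by (auto simp: mgraph_def)
  have nv: "n v = 0" using d(6)[OF v(1)] v(3) by simp
  let ?U = "U - {v}"
  have finU: "finite ?U" using d(4) by simp
  have w0: "w x v = 0" if "x \<in> U" "x \<noteq> b" for x
    using b(3)[OF that] w(2)[of x v] by simp
  have "(\<Sum>y\<in>U. w v y) = w v b"
    using d(4) b by (simp add: sum.remove)
  moreover have "even (\<tau> v + n v + (\<Sum>y\<in>U. w v y))"
    using d(1) v(1) unfolding balanced_def by blast
  moreover have "even (\<tau> v)" using v(2) by (metis dvd_mult_left)
  ultimately have ev: "even (w v b)" using nv by simp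
  have evx: "even (w x v)" if "x \<in> U" for x
    using w0[OF that] ev w(2)[of v b] by (cases "x = b") auto
  have rows: "(\<Sum>y\<in>U. h y) = h v + (\<Sum>y\<in>?U. h y)" for h :: "'a \<Rightarrow> int"
    using d(4) v(1) by (simp add: sum.remove)
  have bal: "balanced ?U w c n \<tau>"
    unfolding balanced_def
  proof (intro conjI ballI finU d(5))
    fix x assume x: "x \<in> ?U"
    then show "\<bar>n x\<bar> \<le> c x" "even (c x - n x)" using d(6,8) by auto
    have "even (\<tau> x + n x + (\<Sum>y\<in>U. w x y))" using d(1) x by (auto simp: balanced_def)
    then show "even (\<tau> x + n x + (\<Sum>y\<in>?U. w x y))" using evx[of x] x rows[of "w x"] by simp
  next
    have "(\<Sum>x\<in>U. \<tau> x + n x) = \<tau> v + (\<Sum>x\<in>?U. \<tau> x + n x)" using rows[of "\<lambda>x. \<tau> x + n x"] nv by simp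
    then show "2 * m dvd (\<Sum>x\<in>?U. \<tau> x + n x)"
      using d(9) dvd_add_right_iff[OF v(2)] by simp
  qed
  have nds: "nd (\<tau> v + t) = nd t" for t
    using v(2) by (intro nd_cong) simp
  have "2 * m - 2 + nd (sum \<tau> A) \<le> deg ?U w c A"
    if A: "A \<subseteq> ?U" "A \<noteq> {}" "A \<noteq> ?U" for A
  proof -
    have finA: "finite A" and vA: "v \<notin> A" using A finite_subset[OF A(1) finU] by auto
    show ?thesis
    proof (cases "b \<in> A")
      case True
      have "insert v A \<subseteq> U" "insert v A \<noteq> U" "insert v A \<noteq> {v}" using A v(1) by auto
      then have *: "2 * m - 2 + nd (sum \<tau> (insert v A)) \<le> deg U w c (insert v A)"
        using admissible_good[OF i, of "insert v A"] by blast
      have D: "U - insert v A = ?U - A" by blast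
      have "(\<Sum>y\<in>?U - A. w v y) = 0"
        using b(3) True by (intro sum.neutral) auto
      then have "deg U w c (insert v A) = deg ?U w c A"
        using finA vA v(3) unfolding deg_def cut_size_def D by simp
      then show ?thesis using * finA vA nds by simp
    next
      case False
      have "A \<subseteq> U" "A \<noteq> U" "A \<noteq> {v}" using A vA v(1) by auto
      then have *: "2 * m - 2 + nd (sum \<tau> A) \<le> deg U w c A"
        using admissible_good[OF i, of A] A(2) by blast
      have "(\<Sum>y\<in>U - A. w x y) = (\<Sum>y\<in>?U - A. w x y)" if "x \<in> A" for x
      proof -
        have "U - A = insert v (?U - A)" using vA v(1) by blast
        moreover have "w x v = 0" using w0 that A False by blast
        ultimately show ?thesis using finU by simp
      qed
      then have "deg U w c A = deg ?U w c A" unfolding deg_def cut_size_def by simp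
      then show ?thesis using * by simp
    qed
  qed
  moreover have "2 \<le> card ?U" "card ?U < card U" using card v(1) d(4) by auto
  moreover have "sum c ?U \<le> 2 * m - 2 + nd (sum \<tau> ?U)"
    using d(3) rows[of c] rows[of \<tau>] v(3) nds by simp
  ultimately have "admissible ?U w c n \<tau> v" "smaller ?U w c U w c"
    using bal by (simp_all add: admissible_def good_def smaller_def)
  then have "realizable ?U w (\<lambda>x. \<tau> x + n x)"
    using red unfolding reduces_def by blast
  then obtain f where f: "orients w f" "\<And>x. x \<in> ?U \<Longrightarrow> 2 * m dvd (\<Sum>y\<in>?U. f x y) - (\<tau> x + n x)"
    unfolding realizable_def by blast
  \<comment> \<open>The net flow between \<open>v\<close> and \<open>b\<close> is reset to 0, as the
    parity of \<open>w v b\<close> permits.\<close>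
  define F where "F = (\<lambda>x y. f x y + (0 - f v b) * arc v b x y)"
  have "orients w F"
    unfolding F_def using f(1) d(5) b(2)[symmetric] by (rule orients_set) (use w(1) ev in auto)
  moreover have "2 * m dvd (\<Sum>y\<in>U. F x y) - (\<tau> x + n x)" if x: "x \<in> U" for x
  proof (cases "x = v")
    case True
    have "F v y = 0" if "y \<in> U" for y
    proof (cases "y = b")
      case True
      then show ?thesis using b(2) by (simp add: F_def arc_def)
    next
      case False
      then have "f v y = 0" using orientsD(2)[OF f(1), of v y] b(3)[OF that] by simp
      then show ?thesis using False b(2) by (simp add: F_def arc_def)
    qed
    then show ?thesis using True v(2) nv by simp
  next
    case False
    have "F x v = 0"
    proof (cases "x = b")
      case True
      then show ?thesis using b(2) orientsD(1)[OF f(1), of b v] by (simp add: F_def arc_def)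
    next
      case xb: False
      then have "f x v = 0" using orientsD(2)[OF f(1), of x v] w0[OF x] by simp
      then show ?thesis using False xb by (simp add: F_def arc_def)
    qed
    moreover have "(\<Sum>y\<in>?U. F x y) = (\<Sum>y\<in>?U. f x y)"
      using False by (intro sum.cong) (auto simp: F_def arc_def)
    ultimately show ?thesis using f(2)[of x] x False rows[of "F x"] by simp
  qed
  ultimately show ?thesis unfolding realizable_def by blast
qed

lemma zero_vertex_step:
  assumes i: "admissible U w c n \<tau> v" and sl: "slack U w c \<tau>" and red: "reduces U w c"
    and v: "v \<in> U" "2 * m dvd \<tau> v" and card: "3 \<le> card U"
  shows "realizable U w (\<lambda>x. \<tau> x + n x)"
proof (cases "0 < c v")
  case True
  then show ?thesis using lift_through_special[OF i sl red v _ card] by blast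
next
  case False
  note d = admissibleD[OF i]
  have cv: "c v = 0" using False d(7)[OF v(1)] by simp
  have w: "0 \<le> w x y" "w x x = 0" for x y using d(5) by (auto simp: mgraph_def)
  show ?thesis
  proof (cases "\<exists>a\<in>U. \<exists>b\<in>U. a \<noteq> b \<and> 0 < w v a \<and> 0 < w v b")
    case True
    then show ?thesis using lift_inside[OF i sl red v] by blast
  next
    case False
    have "\<exists>b\<in>U. b \<noteq> v \<and> (\<forall>x\<in>U. x \<noteq> b \<longrightarrow> w v x = 0)"
    proof (cases "\<exists>b\<in>U. 0 < w v b")
      case True
      then obtain b where b: "b \<in> U" "0 < w v b" by blast
      then have "\<not> 0 < w v x" if "x \<in> U" "x \<noteq> b" for x
        using False that by blast
      then have "w v x = 0" if "x \<in> U" "x \<noteq> b" for x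
        using that w(1)[of v x] by force
      moreover have "b \<noteq> v" using b w(2) by auto
      ultimately show ?thesis using b by blast
    next
      case no: False
      have "U \<noteq> {v}" using card by auto
      then obtain b where "b \<in> U" "b \<noteq> v" using v(1) by blast
      moreover have "w v x = 0" if "x \<in> U" for x
        using no that w(1)[of v x] by force
      ultimately show ?thesis by blast
    qed
    then show ?thesis using drop_vertex[OF i red v cv card] by blast
  qed
qed

end

subsection \<open>Contraction of tight sets\<close>

text \<open>Spreads the net flow between a contracted vertex and an outside vertex over the members
  of the contracted set.\<close>

lemma split_flow:
  fixes h :: "'v \<Rightarrow> int"
  assumes "finite A" "\<And>x. 0 \<le> h x" "\<bar>F\<bar> \<le> sum h A" "even (sum h A - F)"
  shows "\<exists>g. (\<forall>x\<in>A. \<bar>g x\<bar> \<le> h x \<and> even (h x - g x)) \<and> sum g A = F"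
  using assms(1,3,4)
proof (induction A arbitrary: F)
  case empty
  then show ?case by simp
next
  case (insert x A)
  have nn: "0 \<le> h x" "0 \<le> sum h A" using assms(2) by (auto intro: sum_nonneg)
  have F: "- (h x + sum h A) \<le> F" "F \<le> h x + sum h A" "even (h x + sum h A - F)"
    using insert.prems insert.hyps by auto
  \<comment> \<open>Greedy choice: \<open>r\<close> is the larger of \<open>- h x\<close> and
    \<open>F - sum h A\<close>, the least value that the remaining elements can complete to
    \<open>F\<close>.\<close>
  obtain r where r: "\<bar>r\<bar> \<le> h x" "even (h x - r)" "\<bar>F - r\<bar> \<le> sum h A" "even (sum h A - (F - r))"
  proof (cases "F - sum h A \<le> - h x")
    case True
    have "even (sum h A - (F - - h x))" using F(3) by (simp add: algebra_simps)
    moreover have "\<bar>F - - h x\<bar> \<le> sum h A" using True F(1) by linarith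
    ultimately show thesis using that[of "- h x"] nn(1) by simp
  next
    case False
    have "even (h x - (F - sum h A))" using F(3) by (simp add: algebra_simps)
    then show thesis using that[of "F - sum h A"] False F(2) nn by simp
  qed
  obtain g where g: "\<forall>y\<in>A. \<bar>g y\<bar> \<le> h y \<and> even (h y - g y)" "sum g A = F - r"
    using insert.IH[OF r(3,4)] by blast
  have ag: "sum (g(x := r)) A = sum g A"
    using insert.hyps by (intro sum.cong) auto
  then have "sum (g(x := r)) (insert x A) = F"
    using insert.hyps g(2) by simp
  moreover have "\<forall>y\<in>insert x A. \<bar>(g(x := r)) y\<bar> \<le> h y \<and> even (h y - (g(x := r)) y)"
    using g(1) r(1,2) insert.hyps(2) by auto
  ultimately show ?case by blast
qed

text \<open>Contracting \<open>A\<close> keeps the name of a representative \<open>a \<in> A\<close> for the new vertex.\<close>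
definition fibre :: "'v set \<Rightarrow> 'v \<Rightarrow> 'v \<Rightarrow> 'v set" where
  "fibre A a x = (if x = a then A else {x})"

definition contract_graph :: "'v set \<Rightarrow> 'v \<Rightarrow> ('v \<Rightarrow> 'v \<Rightarrow> int) \<Rightarrow> 'v \<Rightarrow> 'v \<Rightarrow> int" where
  "contract_graph A a w x y = (if x = y then 0 else \<Sum>p\<in>fibre A a x. \<Sum>q\<in>fibre A a y. w p q)"

definition contract_fun :: "'v set \<Rightarrow> 'v \<Rightarrow> ('v \<Rightarrow> int) \<Rightarrow> 'v \<Rightarrow> int" where
  "contract_fun A a g x = sum g (fibre A a x)"

context
  fixes U A :: "'v set" and a :: 'v
  assumes fin: "finite U" and A: "A \<subseteq> U" and a: "a \<in> A"
begin

lemma finA: "finite A"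
  using fin A by (rule rev_finite_subset)

lemma sum_fibres:
  assumes "B \<subseteq> insert a (U - A)"
  shows "sum g (\<Union>x\<in>B. fibre A a x) = (\<Sum>x\<in>B. sum g (fibre A a x))"
proof (rule sum.UNION_disjoint)
  show "finite B" using assms fin by (meson finite.insertI finite_Diff rev_finite_subset)
  show "\<forall>x\<in>B. finite (fibre A a x)" using finA by (simp add: fibre_def)
  show "\<forall>x\<in>B. \<forall>y\<in>B. x \<noteq> y \<longrightarrow> fibre A a x \<inter> fibre A a y = {}"
    using assms by (auto simp: fibre_def)
qed

lemma sum_contract_fun:
  assumes "B \<subseteq> insert a (U - A)"
  shows "sum (contract_fun A a g) B = sum g (\<Union>x\<in>B. fibre A a x)"
  using sum_fibres[OF assms, of g] by (simp add: contract_fun_def)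

lemma fibres_subset: "B \<subseteq> insert a (U - A) \<Longrightarrow> (\<Union>x\<in>B. fibre A a x) \<subseteq> U"
  using A by (auto simp: fibre_def split: if_splits)

lemma fibres_Diff:
  assumes "B \<subseteq> insert a (U - A)"
  shows "U - (\<Union>x\<in>B. fibre A a x) = (\<Union>x\<in>insert a (U - A) - B. fibre A a x)"
  using assms A a by (auto simp: fibre_def split: if_splits)

lemma cut_size_contract:
  assumes B: "B \<subseteq> insert a (U - A)"
  shows "cut_size (insert a (U - A)) (contract_graph A a w) B = cut_size U w (\<Union>x\<in>B. fibre A a x)"
proof -
  have "cut_size U w (\<Union>x\<in>B. fibre A a x)
      = (\<Sum>x\<in>B. \<Sum>p\<in>fibre A a x. \<Sum>y\<in>insert a (U - A) - B. \<Sum>q\<in>fibre A a y. w p q)"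
    unfolding cut_size_def fibres_Diff[OF B] by (simp add: sum_fibres[OF B] sum_fibres[OF Diff_subset])
  also have "\<dots> = (\<Sum>x\<in>B. \<Sum>y\<in>insert a (U - A) - B. \<Sum>p\<in>fibre A a x. \<Sum>q\<in>fibre A a y. w p q)"
    by (intro sum.cong[OF refl] sum.swap)
  also have "\<dots> = cut_size (insert a (U - A)) (contract_graph A a w) B"
    unfolding cut_size_def by (intro sum.cong[OF refl]) (auto simp: contract_graph_def)
  finally show ?thesis ..
qed

lemma deg_contract:
  assumes B: "B \<subseteq> insert a (U - A)"
  shows "deg (insert a (U - A)) (contract_graph A a w) (contract_fun A a c) B
    = deg U w c (\<Union>x\<in>B. fibre A a x)"
  using cut_size_contract[OF B] sum_contract_fun[OF B] by (simp add: deg_def)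

lemma mgraph_contract:
  assumes "mgraph w"
  shows "mgraph (contract_graph A a w)"
  unfolding mgraph_def
proof (intro conjI allI)
  fix x y
  have w: "0 \<le> w p q" "w p q = w q p" for p q
    using assms by (auto simp: mgraph_def)
  show "0 \<le> contract_graph A a w x y" by (auto simp: contract_graph_def w intro!: sum_nonneg)
  show "contract_graph A a w x y = contract_graph A a w y x"
    unfolding contract_graph_def by (subst sum.swap) (simp add: w(2))
  show "contract_graph A a w x x = 0" by (simp add: contract_graph_def)
qed

end

context half_modulus
begin

lemma admissible_contract:
  assumes i: "admissible U w c n \<tau> v" and A: "A \<subseteq> U" "2 \<le> card A" "A \<noteq> U" "a \<in> A"
  shows "admissible (insert a (U - A)) (contract_graph A a w) (contract_fun A a c) (contract_fun A a n)
    (contract_fun A a \<tau>) v"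
proof -
  note d = admissibleD[OF i]
  let ?U = "insert a (U - A)" and ?w = "contract_graph A a w"
  note con = d(4) A(1,4)
  have finU: "finite ?U" using d(4) by simp
  have finA: "finite A" using A(1) d(4) finite_subset by blast
  have all: "(\<Union>x\<in>?U. fibre A a x) = U" using A by (auto simp: fibre_def)
  have g: "mgraph ?w" by (rule mgraph_contract[OF con d(5)])
  have fib: "(\<Union>x\<in>{x}. fibre A a x) = fibre A a x" for x by simp
  have bal: "balanced ?U ?w (contract_fun A a c) (contract_fun A a n) (contract_fun A a \<tau>)"
    unfolding balanced_def
  proof (intro conjI ballI finU g)
    fix x assume x: "x \<in> ?U"
    then have sub: "fibre A a x \<subseteq> U" using A(1) by (auto simp: fibre_def)
    have "\<bar>contract_fun A a n x\<bar> \<le> (\<Sum>p\<in>fibre A a x. \<bar>n p\<bar>)"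
      unfolding contract_fun_def by (rule sum_abs)
    also have "\<dots> \<le> contract_fun A a c x"
      unfolding contract_fun_def using d(6) sub by (intro sum_mono) blast
    finally show "\<bar>contract_fun A a n x\<bar> \<le> contract_fun A a c x" .
    have "even (\<Sum>p\<in>fibre A a x. c p - n p)"
      using d(8) sub by (intro dvd_sum) blast
    then show ev: "even (contract_fun A a c x - contract_fun A a n x)"
      by (simp add: contract_fun_def sum_subtractf)
    have "(\<Sum>y\<in>?U. ?w x y) = cut_size U w (fibre A a x)"
      using cut_size_singleton[OF finU x g] cut_size_contract[OF con, of "{x}" w] x by simp
    moreover have "even (deg U w c (fibre A a x) + sum \<tau> (fibre A a x))"
      by (rule deg_parity[OF d(1) sub])
    ultimately show "even (contract_fun A a \<tau> x + contract_fun A a n x + (\<Sum>y\<in>?U. ?w x y))"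
      using ev unfolding deg_def contract_fun_def by presburger
  next
    have "(\<Sum>x\<in>?U. contract_fun A a \<tau> x + contract_fun A a n x) = (\<Sum>x\<in>U. \<tau> x + n x)"
      using sum_contract_fun[OF con subset_refl] all by (simp add: sum.distrib)
    then show "2 * m dvd (\<Sum>x\<in>?U. contract_fun A a \<tau> x + contract_fun A a n x)"
      using d(9) by simp
  qed
  have "2 * m - 2 + nd (sum (contract_fun A a \<tau>) B) \<le> deg ?U ?w (contract_fun A a c) B
      \<or> B = {v} \<and> 2 * m dvd contract_fun A a \<tau> v"
    if B: "B \<subseteq> ?U" "B \<noteq> {}" "B \<noteq> ?U" for B
  proof -
    let ?B = "\<Union>x\<in>B. fibre A a x"
    have "?B \<subseteq> U" by (rule fibres_subset[OF con B(1)])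
    moreover have "?B \<noteq> {}" using B(2) A(4) by (auto simp: fibre_def)
    moreover have "?B \<noteq> U"
    proof -
      obtain z where "z \<in> ?U - B" using B by blast
      then have "z \<in> U - ?B" using fibres_Diff[OF con B(1)] A(4) by (auto simp: fibre_def split: if_splits)
      then show ?thesis by blast
    qed
    ultimately have *: "2 * m - 2 + nd (sum \<tau> ?B) \<le> deg U w c ?B \<or> ?B = {v} \<and> 2 * m dvd \<tau> v"
      by (rule admissible_good[OF i])
    \<comment> \<open>The exemption survives contraction: \<open>A\<close> has at least two
      vertices, so a preimage equal to \<open>{v}\<close> does not involve the contracted
      vertex.\<close>
    have "B = {v} \<and> v \<noteq> a" if s: "?B = {v}"
    proof -
      have "a \<notin> B"
      proof
        assume "a \<in> B"
        then have "A \<subseteq> {v}" using s by (auto simp: fibre_def)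
        then have "card A \<le> 1" using card_mono[of "{v}" A] by simp
        then show False using A(2) by simp
      qed
      then have "?B = B" by (auto simp: fibre_def)
      then show ?thesis using s \<open>a \<notin> B\<close> by auto
    qed
    then show ?thesis
      using * unfolding deg_contract[OF con B(1)] sum_contract_fun[OF con B(1)]
      by (auto simp: contract_fun_def fibre_def)
  qed
  moreover have "2 \<le> card ?U"
  proof -
    have "U - A \<noteq> {}" using A(1,3) by blast
    then have "0 < card (U - A)" using d(4) by (simp add: card_gt_0_iff)
    then show ?thesis using d(4) A(4) by simp
  qed
  moreover have "sum (contract_fun A a c) ?U \<le> 2 * m - 2 + nd (sum (contract_fun A a \<tau>) ?U)"
    using d(3) all sum_contract_fun[OF con subset_refl] by simp
  ultimately show ?thesis using bal by (simp add: admissible_def good_def)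
qed

text \<open>A solution of the contracted graph fixes the arcs leaving \<open>A\<close>. With these
  prescribed, the inside of \<open>A\<close> is again an admissible state with fewer vertices, and
  the two solutions fit together.\<close>

lemma tight_set_step:
  assumes i: "admissible U w c n \<tau> v" and red: "reduces U w c"
    and A: "A \<subseteq> U" "2 \<le> card A" "A \<noteq> U"
    and tight: "deg U w c A = 2 * m - 2 + nd (sum \<tau> A)"
  shows "realizable U w (\<lambda>x. \<tau> x + n x)"
proof -
  note d = admissibleD[OF i]
  have finA: "finite A" using A(1) d(4) finite_subset by blast
  obtain a where a: "a \<in> A" using A(2) by fastforce
  have aU: "a \<in> U" using a A(1) by blast
  note con = d(4) A(1) a
  have w: "0 \<le> w x y" "w x y = w y x" "w x x = 0" for x y
    using d(5) by (auto simp: mgraph_def)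
  let ?U = "insert a (U - A)" and ?w = "contract_graph A a w"
  have cU: "card ?U < card U"
  proof -
    have "card ?U = card (U - A) + 1" using d(4) a by simp
    also have "\<dots> = card U - card A + 1" using A(1) finA by (simp add: card_Diff_subset)
    finally show ?thesis using A(2) card_mono[OF d(4) A(1)] by linarith
  qed
  have "realizable ?U ?w (\<lambda>x. contract_fun A a \<tau> x + contract_fun A a n x)"
    using red admissible_contract[OF i A a] cU unfolding reduces_def smaller_def by blast
  then obtain f1 where f1: "orients ?w f1"
    "\<And>x. x \<in> ?U \<Longrightarrow> 2 * m dvd (\<Sum>y\<in>?U. f1 x y) - (contract_fun A a \<tau> x + contract_fun A a n x)"
    unfolding realizable_def by blast
  have wa: "?w a z = (\<Sum>p\<in>A. w p z)" if "z \<notin> A" for z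
    using that a by (auto simp: contract_graph_def fibre_def)
  have "\<exists>g. (\<forall>x\<in>A. \<bar>g x\<bar> \<le> w x z \<and> even (w x z - g x)) \<and> sum g A = f1 a z" if "z \<notin> A" for z
    using orientsD(2,3)[OF f1(1), of a z] wa[OF that] by (intro split_flow finA w) auto
  then obtain g where g: "\<And>z x. z \<notin> A \<Longrightarrow> x \<in> A \<Longrightarrow> \<bar>g z x\<bar> \<le> w x z \<and> even (w x z - g z x)"
    "\<And>z. z \<notin> A \<Longrightarrow> sum (g z) A = f1 a z"
    by metis
  define c2 where "c2 = (\<lambda>x. c x + (\<Sum>z\<in>U - A. w x z))"
  \<comment> \<open>\<open>g z x\<close> is the net flow from \<open>x\<close> to \<open>z\<close>,
    whereas \<open>n2\<close> counts arcs towards \<open>x\<close> positively; hence the minus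
    sign.\<close>
  define n2 where "n2 = (\<lambda>x. n x - (\<Sum>z\<in>U - A. g z x))"
  have splitU: "(\<Sum>y\<in>U. h y) = (\<Sum>y\<in>A. h y) + (\<Sum>y\<in>U - A. h y)" for h :: "'a \<Rightarrow> int"
    using sum.subset_diff[OF A(1) d(4), of h] by simp
  have f1aa: "f1 a a = 0" by (rule orients_diag[OF f1(1)])
  have sumU: "(\<Sum>y\<in>?U. f1 x y) = f1 x a + (\<Sum>y\<in>U - A. f1 x y)" for x
    using d(4) a by simp
  have bal: "balanced A w c2 n2 \<tau>"
    unfolding balanced_def
  proof (intro conjI ballI finA d(5))
    fix x assume x: "x \<in> A"
    then have xU: "x \<in> U" using A(1) by blast
    have "\<bar>\<Sum>z\<in>U - A. g z x\<bar> \<le> (\<Sum>z\<in>U - A. \<bar>g z x\<bar>)" by (rule sum_abs)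
    also have "\<dots> \<le> (\<Sum>z\<in>U - A. w x z)" using g(1) x by (intro sum_mono) auto
    finally show "\<bar>n2 x\<bar> \<le> c2 x" using d(6)[OF xU] by (simp add: c2_def n2_def)
    have "even (\<Sum>z\<in>U - A. w x z - g z x)" using g(1) x by (intro dvd_sum) auto
    then have ev: "even ((\<Sum>z\<in>U - A. w x z) - (\<Sum>z\<in>U - A. g z x))" by (simp add: sum_subtractf)
    then show "even (c2 x - n2 x)" using d(8)[OF xU] unfolding c2_def n2_def by presburger
    have "even (\<tau> x + n x + (\<Sum>y\<in>U. w x y))" using d(1) xU unfolding balanced_def by blast
    then show "even (\<tau> x + n2 x + (\<Sum>y\<in>A. w x y))"
      using ev splitU[of "w x"] unfolding n2_def by presburger
  next
    \<comment> \<open>The congruence at the contracted vertex becomes the global balance inside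
      \<open>A\<close>.\<close>
    have "(\<Sum>x\<in>A. \<Sum>z\<in>U - A. g z x) = (\<Sum>z\<in>U - A. f1 a z)"
      by (subst sum.swap) (simp add: g(2))
    then have "(\<Sum>x\<in>A. \<tau> x + n2 x) = sum \<tau> A + sum n A - (\<Sum>y\<in>?U. f1 a y)"
      unfolding sumU f1aa by (simp add: n2_def sum.distrib sum_subtractf)
    moreover have "2 * m dvd (\<Sum>y\<in>?U. f1 a y) - (sum \<tau> A + sum n A)"
      using f1(2)[of a] by (simp add: contract_fun_def fibre_def)
    ultimately show "2 * m dvd (\<Sum>x\<in>A. \<tau> x + n2 x)"
      by (metis dvd_diff_commute)
  qed
  have degs: "deg A w c2 B = deg U w c B" if "B \<subseteq> A" for B
  proof -
    have "(\<Sum>y\<in>U - B. w x y) = (\<Sum>y\<in>A - B. w x y) + (\<Sum>y\<in>U - A. w x y)" for x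
    proof -
      have "U - B = (A - B) \<union> (U - A)" using that A(1) by blast
      moreover have "(A - B) \<inter> (U - A) = {}" by blast
      ultimately show ?thesis using d(4) finA by (simp add: sum.union_disjoint)
    qed
    then show ?thesis by (simp add: deg_def cut_size_def c2_def sum.distrib)
  qed
  have "2 * m - 2 + nd (sum \<tau> B) \<le> deg A w c2 B \<or> B = {v} \<and> 2 * m dvd \<tau> v"
    if B: "B \<subseteq> A" "B \<noteq> {}" "B \<noteq> A" for B
  proof -
    have "B \<subseteq> U" "B \<noteq> U" using B A by auto
    then show ?thesis using admissible_good[OF i] B(2) degs[OF B(1)] by simp
  qed
  \<comment> \<open>The new special vertex has the degree of \<open>A\<close>, so
    \<open>tight\<close> provides exactly its upper bound.\<close>
  moreover have "sum c2 A = deg U w c A"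
    by (simp add: c2_def deg_def cut_size_def sum.distrib)
  ultimately have "admissible A w c2 n2 \<tau> v"
    using bal A(2) tight by (simp add: admissible_def good_def)
  moreover have "card A < card U"
    using A d(4) by (simp add: psubset_card_mono psubsetI)
  ultimately have "realizable A w (\<lambda>x. \<tau> x + n2 x)"
    using red unfolding reduces_def smaller_def by blast
  then obtain f2 where f2: "orients w f2"
    "\<And>x. x \<in> A \<Longrightarrow> 2 * m dvd (\<Sum>y\<in>A. f2 x y) - (\<tau> x + n2 x)"
    unfolding realizable_def by blast
  define f where "f = (\<lambda>x y. if x \<in> A then if y \<in> A then f2 x y else g y x
    else if y \<in> A then - g x y else f1 x y)"
  have wout: "?w x y = w x y" if "x \<notin> A" "y \<notin> A" for x y
    using that a w(3) by (auto simp: contract_graph_def fibre_def)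
  have "orients w f"
    unfolding orients_def
  proof (intro allI)
    fix x y
    consider "x \<in> A" "y \<in> A" | "x \<in> A" "y \<notin> A" | "x \<notin> A" "y \<in> A" | "x \<notin> A" "y \<notin> A" by blast
    then show "f y x = - f x y \<and> \<bar>f x y\<bar> \<le> w x y \<and> even (w x y - f x y)"
    proof cases
      case 1
      then show ?thesis using orientsD(1)[OF f2(1), of y x] orientsD(2,3)[OF f2(1), of x y]
        by (simp add: f_def)
    next
      case 2
      then show ?thesis using g(1)[of y x] by (simp add: f_def)
    next
      case 3
      then show ?thesis using g(1)[of x y] w(2)[of x y] by (simp add: f_def)
    next
      case 4
      then show ?thesis using orientsD(1)[OF f1(1), of y x] orientsD(2,3)[OF f1(1), of x y] wout[of x y]
        by (simp add: f_def)
    qed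
  qed
  moreover have "2 * m dvd (\<Sum>y\<in>U. f x y) - (\<tau> x + n x)" if x: "x \<in> U" for x
  proof (cases "x \<in> A")
    case True
    have "(\<Sum>y\<in>U. f x y) = (\<Sum>y\<in>A. f2 x y) + (\<Sum>y\<in>U - A. g y x)"
      unfolding splitU[of "f x"] using True by (simp add: f_def)
    then have eq: "(\<Sum>y\<in>U. f x y) - (\<tau> x + n x) = (\<Sum>y\<in>A. f2 x y) - (\<tau> x + n2 x)"
      by (simp add: n2_def)
    show ?thesis unfolding eq by (rule f2(2)[OF True])
  next
    case False
    have "(\<Sum>y\<in>U. f x y) = - sum (g x) A + (\<Sum>y\<in>U - A. f1 x y)"
      unfolding splitU[of "f x"] using False by (simp add: f_def sum_negf)
    also have "\<dots> = (\<Sum>y\<in>?U. f1 x y)"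
      unfolding sumU using g(2)[OF False] orientsD(1)[OF f1(1), of x a] by simp
    finally have eq: "(\<Sum>y\<in>U. f x y) = (\<Sum>y\<in>?U. f1 x y)" .
    have "x \<noteq> a" using False a by blast
    then show ?thesis
      unfolding eq using f1(2)[of x] x False by (simp add: contract_fun_def fibre_def)
  qed
  ultimately show ?thesis unfolding realizable_def by blast
qed

end

subsection \<open>The extension theorem\<close>

context half_modulus
begin

text \<open>Directing the edge from the positive to the negative vertex lowers both degrees and both
  demand distances by 1 and keeps the total demand.\<close>

lemma opposite_edge_step:
  assumes i: "admissible U w c n \<tau> v" and sl: "slack U w c \<tau>" and red: "reduces U w c"
    and g: "\<And>x. x \<in> U \<Longrightarrow> 2 * m - 2 + nd (\<tau> x) \<le> deg U w c {x}"
    and xy: "x \<in> U" "y \<in> U" "0 < w x y" "pos (\<tau> x)" "pos (- \<tau> y)"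
  shows "realizable U w (\<lambda>x. \<tau> x + n x)"
proof -
  note d = admissibleD[OF i]
  have "x \<noteq> y" using xy d(5) by (auto simp: mgraph_def)
  then show ?thesis
  proof (rule edge_step[OF i sl red xy(1,2) _ xy(3), where s = 1 and a = 0 and a' = 0 and e = "- 1"
        and b = 0 and b' = 0 and g = 1])
    show "2 * m - 2 + nd (\<tau> x + - 1) \<le> deg U w c {x} + 0 - 1 \<or> x = v \<and> 2 * m dvd \<tau> x + - 1"
      using g[OF xy(1)] pos_nd_diff_1[OF xy(4)] by simp
    show "2 * m - 2 + nd (\<tau> y + 1) \<le> deg U w c {y} + 0 - 1 \<or> y = v \<and> 2 * m dvd \<tau> y + 1"
      using g[OF xy(2)] neg_nd_add_1[OF xy(5)] by simp
  qed (use d(3) d(6)[OF xy(1)] d(6)[OF xy(2)] in auto)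
qed

lemma edge_across:
  assumes i: "admissible U w c n \<tau> v"
    and g: "\<And>A. A \<subseteq> U \<Longrightarrow> A \<noteq> {} \<Longrightarrow> A \<noteq> U \<Longrightarrow> 2 * m - 2 + nd (sum \<tau> A) \<le> deg U w c A"
    and A: "A \<subseteq> U" "A \<noteq> {}" "A \<noteq> U"
  shows "\<exists>x\<in>A. \<exists>y\<in>U - A. 0 < w x y"
proof (rule ccontr)
  assume no: "\<not> ?thesis"
  have "U - A \<subseteq> U" "U - A \<noteq> {}" "U - A \<noteq> U" using A by auto
  then have "m - 1 \<le> cut_size U w A"
    by (intro cut_lower_bound[OF i A(1)] g A)
  moreover have "cut_size U w A \<le> 0"
    unfolding cut_size_def using no by (intro sum_nonpos) (meson not_le)
  ultimately show False using m_ge_2 by simp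
qed

lemma all_pos_step:
  assumes i: "admissible U w c n \<tau> v" and sl: "slack U w c \<tau>" and red: "reduces U w c"
    and g: "\<And>A. A \<subseteq> U \<Longrightarrow> A \<noteq> {} \<Longrightarrow> A \<noteq> U \<Longrightarrow> 2 * m - 2 + nd (sum \<tau> A) \<le> deg U w c A"
    and pos: "\<And>x. x \<in> U \<Longrightarrow> pos (\<tau> x)" and card: "3 \<le> card U"
  shows "realizable U w (\<lambda>x. \<tau> x + n x)"
proof -
  note d = admissibleD[OF i]
  have gx: "2 * m - 2 + nd (\<tau> x) \<le> deg U w c {x}" if "x \<in> U" for x
  proof -
    have "{x} \<noteq> U" using card by auto
    then show ?thesis using g[of "{x}"] that by simp
  qed
  obtain z where z: "z \<in> U" using card by fastforce
  have zU: "{z} \<noteq> U" using card by auto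
  obtain x where x: "x \<in> U" "0 < w z x"
    using edge_across[OF i g, of "{z}"] z zU by auto
  have xz: "x \<noteq> z" and wxz: "0 < w x z" using x d(5) by (auto simp: mgraph_def)
  \<comment> \<open>In \<open>slack\<close> the special vertex has room for one more edge after the
    total demand falls by 1; in \<open>trim\<close> some arc enters it; in \<open>full\<close> it is
    a source without such room.\<close>
  consider (slack) "sum c U + 1 \<le> 2 * m - 2 + nd (sum \<tau> U - 1)"
    | (trim) y where "y \<in> U" "n y < c y"
    | (full) "2 * m - 2 + nd (sum \<tau> U - 1) < sum c U + 1" "\<And>y. y \<in> U \<Longrightarrow> n y = c y"
    using d(6) by (metis abs_le_D1 linorder_not_less order_le_less)
  then show ?thesis
  proof cases
    case slack
    \<comment> \<open>The edge \<open>xz\<close> gives way to an arc from the special vertex to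
      \<open>z\<close>, and the demand of \<open>x\<close> falls by 1 for the arc that it
      sends.\<close>
    show ?thesis
    proof (rule edge_step[OF i sl red x(1) z xz wxz, where s = 1 and a = 0 and a' = 0 and e = "- 1"
          and b = 1 and b' = 1 and g = 0])
      show "2 * m - 2 + nd (\<tau> x + - 1) \<le> deg U w c {x} + 0 - 1 \<or> x = v \<and> 2 * m dvd \<tau> x + - 1"
        using gx[OF x(1)] pos_nd_diff_1[OF pos[OF x(1)]] by simp
      show "2 * m - 2 + nd (\<tau> z + 0) \<le> deg U w c {z} + 1 - 1 \<or> z = v \<and> 2 * m dvd \<tau> z + 0"
        using gx[OF z] by simp
      show "\<bar>n z + 1\<bar> \<le> c z + 1" using d(6)[OF z] by linarith
    qed (use slack d(6)[OF x(1)] in auto)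
  next
    case trim
    then show ?thesis using special_edge_step[OF i sl red] pos gx by blast
  next
    case full
    define r where "r = nd (sum \<tau> U)"
    have "even (sum c U + r)"
    proof -
      have "even (deg U w c U + sum \<tau> U)" by (rule deg_parity[OF d(1) subset_refl])
      then show ?thesis using nd_parity[of "sum \<tau> U"] by (simp add: deg_def cut_size_def r_def)
    qed
    moreover have "sum c U \<le> 2 * m - 2 + r" using d(3) by (simp add: r_def)
    moreover have "r - 1 \<le> nd (sum \<tau> U - 1)"
      using nd_add_le[of "sum \<tau> U - 1" 1] by (simp add: r_def)
    \<comment> \<open>The degree is at least one below its upper bound, and parity excludes that
      value.\<close>
    ultimately have cU: "sum c U = 2 * m - 2 + r" using full(1) by presburger
    then have "nd (sum \<tau> U - 1) < nd (sum \<tau> U) + 1" using full(1) by (simp add: r_def)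
    moreover have "even (nd (sum \<tau> U - 1)) \<noteq> even (nd (sum \<tau> U))"
      by (simp add: nd_parity)
    ultimately have "nd (sum \<tau> U - 1) < nd (sum \<tau> U)" by (metis zless_add1_eq)
    then have posU: "pos (sum \<tau> U)" by (rule nd_decreasing_imp_pos)
    then have r: "r = sum \<tau> U mod (2 * m)" "0 < r" "r \<le> m"
      using pos_nd[of "sum \<tau> U"] by (auto simp: r_def pos_def)
    \<comment> \<open>At a source the degree \<open>2 * m - 2 + r\<close> plus the total demand,
      congruent to \<open>r\<close>, is a multiple of \<open>2 * m\<close>. So \<open>m\<close>
      divides \<open>r - 1\<close>, and the range of \<open>r\<close> leaves only
      \<open>r = 1\<close>.\<close>
    have "(\<Sum>x\<in>U. \<tau> x + n x) = sum \<tau> U + sum c U"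
      using full(2) by (simp add: sum.distrib)
    then have t1: "2 * m dvd sum \<tau> U + (2 * m - 2 + r)" using d(9) cU by simp
    have t2: "2 * m dvd sum \<tau> U - r" unfolding r(1) by (simp add: mod_eq_dvd_iff[symmetric])
    have "2 * m dvd (sum \<tau> U + (2 * m - 2 + r)) - (sum \<tau> U - r) - 2 * m"
      by (rule dvd_diff[OF dvd_diff[OF t1 t2] dvd_refl])
    then have "2 * m dvd 2 * (r - 1)" by (simp add: algebra_simps)
    then have "m dvd r - 1" by (simp only: dvd_mult_cancel_left) simp
    then have "r = 1" using r(2,3) zdvd_not_zless[of "r - 1" m] by fastforce
    \<comment> \<open>\<open>j\<close> new arcs lift the residue of \<open>\<tau> z\<close> exactly
      to \<open>m\<close>; the arc from \<open>x\<close> then brings it to \<open>m + 1\<close>, at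
      distance \<open>m - 1\<close>.\<close>
    define j where "j = m - \<tau> z mod (2 * m)"
    have j: "0 \<le> j" "j \<le> m - 1" using pos[OF z] by (auto simp: j_def pos_def)
    have ndz: "nd (\<tau> z) = m - j" using pos_nd[OF pos[OF z]] by (simp add: j_def)
    have "nd (\<tau> z + (j + 1)) = nd (m + 1)"
    proof (rule nd_cong)
      have "2 * m dvd \<tau> z - \<tau> z mod (2 * m)" by (simp add: mod_eq_dvd_iff[symmetric])
      then show "2 * m dvd \<tau> z + (j + 1) - (m + 1)" by (simp add: j_def algebra_simps)
    qed
    also have "nd (m + 1) = nd (1 - m)" by (rule nd_cong) simp
    also have "\<dots> = m - 1" using m_ge_2 by (simp add: nd_small)
    finally have ndz': "nd (\<tau> z + (j + 1)) = m - 1" .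
    \<comment> \<open>The total demand distance grows from 1 to \<open>j + 1\<close>, which pays
      exactly for the \<open>j\<close> new edges at the special vertex.\<close>
    have "nd (sum \<tau> U + - 1 + (j + 1)) = nd (j + 1)"
    proof (rule nd_cong)
      show "2 * m dvd sum \<tau> U + - 1 + (j + 1) - (j + 1)"
        using t2 \<open>r = 1\<close> by simp
    qed
    also have "\<dots> = j + 1" using j by (simp add: nd_small)
    finally have ndU: "nd (sum \<tau> U + - 1 + (j + 1)) = j + 1" .
    show ?thesis
      \<comment> \<open>The new arcs from \<open>z\<close> to the special vertex push \<open>\<tau> z\<close> past \<open>m\<close>, so that \<open>z\<close>
        counts as negative and the edge \<open>xz\<close> joins vertices of opposite sign.\<close>
    proof (rule edge_step[OF i sl red x(1) z xz wxz, where s = 1 and a = 0 and a' = 0 and e = "- 1"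
          and b = j and b' = "- j" and g = "j + 1"])
      show "2 * m - 2 + nd (\<tau> x + - 1) \<le> deg U w c {x} + 0 - 1 \<or> x = v \<and> 2 * m dvd \<tau> x + - 1"
        using gx[OF x(1)] pos_nd_diff_1[OF pos[OF x(1)]] by simp
      show "2 * m - 2 + nd (\<tau> z + (j + 1)) \<le> deg U w c {z} + j - 1 \<or> z = v \<and> 2 * m dvd \<tau> z + (j + 1)"
        using gx[OF z] ndz' ndz by linarith
      show "\<bar>n z + - j\<bar> \<le> c z + j" using d(6)[OF z] j by linarith
      show "sum c U + 0 + j \<le> 2 * m - 2 + nd (sum \<tau> U + - 1 + (j + 1))"
        using ndU cU \<open>r = 1\<close> by simp
    qed (use j d(6)[OF x(1)] in auto)
  qed
qed

section \<open>Reversal of all arcs and the complete induction\<close>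

lemma admissible_uminus:
  assumes "admissible U w c n \<tau> v"
  shows "admissible U w c (\<lambda>x. - n x) (\<lambda>x. - \<tau> x) v"
proof -
  have "(\<Sum>x\<in>U. - \<tau> x + - n x) = - (\<Sum>x\<in>U. \<tau> x + n x)"
    by (simp add: sum.distrib sum_negf sum_subtractf)
  moreover have "even (- t + - s + u) = even (t + s + u)" for t s u :: int by presburger
  ultimately show ?thesis
    using assms unfolding admissible_def balanced_def good_def by (simp add: sum_negf)
qed

lemma realizable_uminus:
  assumes "realizable U w (\<lambda>x. - t x)"
  shows "realizable U w t"
proof -
  obtain f where f: "orients w f" "\<And>x. x \<in> U \<Longrightarrow> 2 * m dvd (\<Sum>y\<in>U. f x y) - - t x"
    using assms unfolding realizable_def by blast
  have "orients w (\<lambda>x y. f y x)"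
    unfolding orients_def
  proof (intro allI conjI)
    fix x y
    show "f x y = - f y x" by (rule orientsD(1)[OF f(1)])
    show "\<bar>f y x\<bar> \<le> w x y" "even (w x y - f y x)"
      using orientsD(1)[OF f(1), of y x] orientsD(2,3)[OF f(1), of x y] by simp_all
  qed
  moreover have "2 * m dvd (\<Sum>y\<in>U. f y x) - t x" if "x \<in> U" for x
  proof -
    have "(\<Sum>y\<in>U. f y x) = - (\<Sum>y\<in>U. f x y)"
      unfolding sum_negf[symmetric] by (intro sum.cong refl orientsD(1)[OF f(1)])
    then have "(\<Sum>y\<in>U. f y x) - t x = - ((\<Sum>y\<in>U. f x y) - - t x)" by simp
    then show ?thesis using f(2)[OF that] by (simp only: dvd_minus_iff)
  qed
  ultimately show ?thesis unfolding realizable_def by blast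
qed

lemma admissible_step:
  assumes i: "admissible U w c n \<tau> v" and red: "reduces U w c"
  shows "realizable U w (\<lambda>x. \<tau> x + n x)"
proof (cases "card U = 2")
  case True
  then show ?thesis using base_case[OF i] by blast
next
  case False
  note d = admissibleD[OF i]
  have card: "3 \<le> card U" using False d(2) by linarith
  show ?thesis
  proof (cases "\<exists>A. A \<subseteq> U \<and> 2 \<le> card A \<and> A \<noteq> U \<and> deg U w c A = 2 * m - 2 + nd (sum \<tau> A)")
    case True
    then show ?thesis using tight_set_step[OF i red] by blast
  next
    case no_tight: False
    have sl: "slack U w c \<tau>"
      unfolding slack_def
    proof (intro allI impI)
      fix A assume A: "A \<subseteq> U \<and> 2 \<le> card A \<and> A \<noteq> U"
      then have "A \<noteq> {}" "A \<noteq> {v}" by auto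
      then have "good U w c \<tau> A" using admissible_good[OF i, of A] A unfolding good_def by blast
      then show "2 * m + nd (sum \<tau> A) \<le> deg U w c A"
        using good_slack[OF d(1)] A no_tight by blast
    qed
    show ?thesis
    proof (cases "\<exists>z\<in>U. 2 * m dvd \<tau> z")
      case True
      \<comment> \<open>If the exemption of \<open>v\<close> is not in force, all sets are good and
        it can be handed to another vertex of demand 0.\<close>
      have "\<exists>z. z \<in> U \<and> 2 * m dvd \<tau> z \<and> admissible U w c n \<tau> z"
      proof (cases "v \<in> U \<and> 2 * m dvd \<tau> v")
        case True
        then show ?thesis using i by blast
      next
        case False
        then have "good U w c \<tau> A" if "A \<subseteq> U" "A \<noteq> {}" "A \<noteq> U" for A
          using admissible_good[OF i that] that(1) unfolding good_def by blast
        then show ?thesis using True i unfolding admissible_def by blast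
      qed
      then show ?thesis using zero_vertex_step[OF _ sl red _ _ card] by blast
    next
      case nz: False
      have g: "2 * m - 2 + nd (sum \<tau> A) \<le> deg U w c A" if "A \<subseteq> U" "A \<noteq> {}" "A \<noteq> U" for A
        using admissible_good[OF i that] that(1) nz by blast
      have gx: "2 * m - 2 + nd (\<tau> x) \<le> deg U w c {x}" if "x \<in> U" for x
      proof -
        have "{x} \<noteq> U" using card by auto
        then show ?thesis using g[of "{x}"] that by simp
      qed
      have sgn: "pos (\<tau> x) \<or> pos (- \<tau> x)" if "x \<in> U" for x
        using pos_cases nz that by blast
      let ?P = "{x \<in> U. pos (\<tau> x)}"
      consider "?P = U" | "?P = {}" | "?P \<noteq> {}" "?P \<noteq> U" by blast
      then show ?thesis
      proof cases
        case 1
        then have p: "pos (\<tau> x)" if "x \<in> U" for x using that by blast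
        show ?thesis by (rule all_pos_step[OF i sl red g p card])
      next
        case 2
        then have neg: "pos (- \<tau> x)" if "x \<in> U" for x using sgn that by blast
        have sl': "slack U w c (\<lambda>x. - \<tau> x)" using sl by (simp add: slack_def sum_negf)
        have g': "2 * m - 2 + nd (sum (\<lambda>x. - \<tau> x) A) \<le> deg U w c A"
          if "A \<subseteq> U" "A \<noteq> {}" "A \<noteq> U" for A
          using g[OF that] by (simp add: sum_negf)
        have "realizable U w (\<lambda>x. - \<tau> x + - n x)"
          by (rule all_pos_step[OF admissible_uminus[OF i] sl' red g' neg card])
        then have "realizable U w (\<lambda>x. - (\<tau> x + n x))" by simp
        then show ?thesis by (rule realizable_uminus)
      next
        case 3
        obtain x y where "x \<in> ?P" "y \<in> U - ?P" "0 < w x y"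
          using edge_across[OF i g _ 3] by blast
        then show ?thesis using opposite_edge_step[OF i sl red gx, of x y] sgn by blast
      qed
    qed
  qed
qed

theorem admissible_realizable:
  assumes "admissible U w c n \<tau> v"
  shows "realizable U w (\<lambda>x. \<tau> x + n x)"
proof -
  \<comment> \<open>Both sums are nonnegative for an admissible smaller state, so applying
    \<open>nat\<close> preserves each strict decrease.\<close>
  define \<mu> where "\<mu> = (\<lambda>(U :: 'a set, w, c). (card U, nat (total U w), nat (sum c U)))"
  let ?R = "less_than <*lex*> less_than <*lex*> less_than"
  have wf: "wf ?R" by (intro wf_lex_prod wf_less_than)
  have "\<forall>n \<tau> v. admissible U w c n \<tau> v \<longrightarrow> realizable U w (\<lambda>x. \<tau> x + n x)"
    if "\<mu> (U, w, c) = k" for k and U :: "'a set" and w c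
    using that
  proof (induction k arbitrary: U w c rule: wf_induct_rule[OF wf])
    case (1 k)
    have "realizable U' w' (\<lambda>x. \<tau>' x + n' x)"
      if i': "admissible U' w' c' n' \<tau>' v'" and s: "smaller U' w' c' U w c" for U' w' c' n' \<tau>' v'
    proof -
      have "0 \<le> total U' w'" "0 \<le> sum c' U'"
        using admissibleD(5,7)[OF i'] by (auto simp: total_def mgraph_def intro!: sum_nonneg)
      then have "(\<mu> (U', w', c'), k) \<in> ?R"
        using s 1(2)[symmetric] by (auto simp: \<mu>_def smaller_def)
      then show ?thesis using 1(1) i' by blast
    qed
    then have "reduces U w c" unfolding reduces_def by blast
    then show ?case by (intro allI impI) (rule admissible_step)
  qed
  then show ?thesis using assms by blast
qed

end

subsection \<open>Flows\<close>

text \<open>Returns from multiplicities to named arcs: \<open>\<psi> a\<close> is 1 if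
  \<open>a\<close> keeps its given direction and - 1 if it is reversed.\<close>

lemma orients_arcs:
  assumes "finite A" "\<And>a. a \<in> A \<Longrightarrow> tail a \<noteq> head a"
    and "orients (\<lambda>x y. \<Sum>a\<in>A. edge (tail a) (head a) x y) f"
  shows "\<exists>\<psi>. (\<forall>a\<in>A. \<psi> a = 1 \<or> \<psi> a = - 1) \<and>
    (\<forall>x y. f x y = (\<Sum>a\<in>A. \<psi> a * arc (tail a) (head a) x y))"
  using assms
proof (induction A arbitrary: f)
  case empty
  then have "f x y = 0" for x y using orientsD(2)[of "\<lambda>x y. 0" f x y] by simp
  then show ?case by simp
next
  case (insert b A)
  let ?w = "\<lambda>x y. \<Sum>a\<in>A. edge (tail a) (head a) x y"
  have b: "tail b \<noteq> head b" using insert.prems(1) by simp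
  have nn: "0 \<le> ?w x y" for x y by (intro sum_nonneg) (simp add: edge_def)
  have o: "orients (\<lambda>x y. ?w x y + edge (tail b) (head b) x y) f"
    using insert.prems(2) insert.hyps by (simp add: add.commute)
  obtain s where s: "s = 1 \<or> s = - 1" "orients ?w (\<lambda>x y. f x y - s * arc (tail b) (head b) x y)"
  proof (rule orients_split_edge[OF o nn nn b])
    assume "orients ?w (\<lambda>x y. f x y - arc (tail b) (head b) x y)"
    then show thesis using that[of 1] by simp
  next
    assume "orients ?w (\<lambda>x y. f x y + arc (tail b) (head b) x y)"
    then show thesis using that[of "- 1"] by simp
  qed
  obtain \<psi> where \<psi>: "\<forall>a\<in>A. \<psi> a = 1 \<or> \<psi> a = - 1"
    "\<And>x y. f x y - s * arc (tail b) (head b) x y = (\<Sum>a\<in>A. \<psi> a * arc (tail a) (head a) x y)"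
    using insert.IH[OF _ s(2)] insert.prems(1) by blast
  have "f x y = (\<Sum>a\<in>insert b A. (\<psi>(b := s)) a * arc (tail a) (head a) x y)" for x y
  proof -
    have "(\<Sum>a\<in>A. (\<psi>(b := s)) a * arc (tail a) (head a) x y) = (\<Sum>a\<in>A. \<psi> a * arc (tail a) (head a) x y)"
      using insert.hyps(2) by (intro sum.cong) auto
    then show ?thesis using insert.hyps \<psi>(2)[of x y] by simp
  qed
  moreover have "\<forall>a\<in>insert b A. (\<psi>(b := s)) a = 1 \<or> (\<psi>(b := s)) a = - 1"
    using s(1) \<psi>(1) by simp
  ultimately show ?case by blast
qed

lemma cut_size_sum: "cut_size U (\<lambda>x y. \<Sum>a\<in>A. w a x y) X = (\<Sum>a\<in>A. cut_size U (w a) X)"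
  unfolding cut_size_def by (subst (2) sum.swap, subst sum.swap) (rule refl)

theorem theorem11:
  fixes k :: nat and V :: "'v set" and A :: "'a set" and tail head :: "'a \<Rightarrow> 'v"
    and \<beta> :: "'v \<Rightarrow> int"
  assumes "k \<ge> 1"
    and "multidigraph V A tail head"
    and "edge_connected (6 * k) V A tail head"
    and "is_boundary (2 * int k + 1) V \<beta>"
  shows "\<exists>f :: 'a \<Rightarrow> int. is_flow_with_boundary (2 * int k + 1) V A tail head \<beta> f \<and>
           (\<forall>a\<in>A. f a mod (2 * int k + 1) \<in> {0, 1})"
proof -
  define m where "m = 2 * int k + 1"
  have m: "3 \<le> m" "odd m" using assms(1) by (auto simp: m_def)
  interpret half_modulus m by unfold_locales (use m in simp)
  have fin: "finite V" "finite A" and ends: "\<And>a. a \<in> A \<Longrightarrow> tail a \<in> V \<and> head a \<in> V \<and> tail a \<noteq> head a"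
    using assms(2) by (auto simp: multidigraph_def)
  have bd: "m dvd (\<Sum>v\<in>V. \<beta> v)"
    using assms(4) by (simp add: is_boundary_def m_def cong_0_iff)
  show ?thesis
  proof (cases "2 \<le> card V")
    case False
    \<comment> \<open>Loops being excluded, fewer than two vertices carry no arc, and a boundary on
      one vertex is 0.\<close>
    have "A = {}"
    proof (rule ccontr)
      assume "A \<noteq> {}"
      then obtain a where "a \<in> A" by blast
      then have "{tail a, head a} \<subseteq> V" "tail a \<noteq> head a" using ends by auto
      then show False using card_mono[OF fin(1), of "{tail a, head a}"] False by simp
    qed
    moreover have "[0 = \<beta> v] (mod m)" if "v \<in> V" for v
    proof -
      have "card V = 1" using False that fin(1) card_gt_0_iff[of V] by fastforce
      then have "V = {v}" using that by (auto simp: card_1_singleton_iff)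
      then show ?thesis using bd by (simp add: cong_0_iff cong_sym_eq[of 0])
    qed
    ultimately show ?thesis
      by (auto simp: is_flow_with_boundary_def out_arcs_def in_arcs_def m_def)
  next
    case True
    define w where "w = (\<lambda>x y. \<Sum>a\<in>A. edge (tail a) (head a) x y)"
    define io where "io = (\<lambda>x. (\<Sum>a\<in>A. if tail a = x then 1 else if head a = x then - 1 else (0::int)))"
    \<comment> \<open>Let a flow be 1 on kept arcs and 0 on reversed ones. The net outdegree after
      reversal is then twice the net flow minus the original net outdegree \<open>io\<close>, so
      this demand encodes the boundary \<open>\<beta>\<close>.\<close>
    define \<tau> where "\<tau> = (\<lambda>x. 2 * \<beta> x - io x)"
    have g: "mgraph w"
      unfolding mgraph_def w_def
    proof (intro conjI allI)
      fix x y
      show "0 \<le> (\<Sum>a\<in>A. edge (tail a) (head a) x y)"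
        by (intro sum_nonneg) (simp add: edge_def)
      show "(\<Sum>a\<in>A. edge (tail a) (head a) x y) = (\<Sum>a\<in>A. edge (tail a) (head a) y x)"
        by (intro sum.cong) (auto simp: edge_def)
      have "edge (tail a) (head a) x x = 0" if "a \<in> A" for a
        using ends[OF that] by (auto simp: edge_def)
      then show "(\<Sum>a\<in>A. edge (tail a) (head a) x x) = 0" by simp
    qed
    have cuts: "cut_size V w X = int (card (cut_arcs A tail head X))" if "X \<subseteq> V" for X
    proof -
      have "cut_size V w X = (\<Sum>a\<in>A. if (tail a \<in> X) = (head a \<in> X) then 0 else 1)"
        unfolding w_def cut_size_sum using that ends fin(1) by (intro sum.cong) (auto simp: cut_size_edge)
      also have "\<dots> = (\<Sum>a\<in>A. if (tail a \<in> X) \<noteq> (head a \<in> X) then 1 else 0)"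
        by (intro sum.cong) auto
      also have "\<dots> = int (card (cut_arcs A tail head X))"
        using fin(2) by (simp add: cut_arcs_def sum.If_cases Int_def)
      finally show ?thesis .
    qed
    have degs: "even ((\<Sum>y\<in>V. w x y) - io x)" for x
    proof -
      have "(\<Sum>y\<in>V. w x y) = (\<Sum>a\<in>A. \<Sum>y\<in>V. edge (tail a) (head a) x y)"
        unfolding w_def by (rule sum.swap)
      then have "(\<Sum>y\<in>V. w x y) - io x
          = (\<Sum>a\<in>A. (\<Sum>y\<in>V. edge (tail a) (head a) x y) - (if tail a = x then 1 else if head a = x then - 1 else 0))"
        by (simp add: io_def sum_subtractf)
      also have "even \<dots>"
      proof (intro dvd_sum)
        fix a assume "a \<in> A"
        then show "even ((\<Sum>y\<in>V. edge (tail a) (head a) x y)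
            - (if tail a = x then 1 else if head a = x then - 1 else 0))"
          using ends[of a] fin(1) by (auto simp: sum_edge)
      qed
      finally show ?thesis .
    qed
    have "sum io V = (\<Sum>a\<in>A. \<Sum>x\<in>V. if tail a = x then 1 else if head a = x then - 1 else 0)"
      unfolding io_def by (rule sum.swap)
    also have "\<dots> = 0"
    proof (rule sum.neutral, rule ballI)
      fix a assume a: "a \<in> A"
      then have "(\<Sum>x\<in>V. if tail a = x then 1 else if head a = x then - 1 else (0::int))
          = (\<Sum>x\<in>V. (if tail a = x then 1 else 0) - (if head a = x then 1 else 0))"
        using ends[of a] by (intro sum.cong) auto
      also have "\<dots> = 0" using ends[OF a] fin(1) by (simp add: sum_subtractf)
      finally show "(\<Sum>x\<in>V. if tail a = x then 1 else if head a = x then - 1 else (0::int)) = 0" .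
    qed
    finally have io0: "sum io V = 0" .
    have bal: "balanced V w (\<lambda>x. 0) (\<lambda>x. 0) \<tau>"
      unfolding balanced_def
    proof (intro conjI ballI fin(1) g)
      show "2 * m dvd (\<Sum>x\<in>V. \<tau> x + 0)"
        using bd io0 by (simp add: \<tau>_def sum_subtractf sum_distrib_left[symmetric])
      show "even (\<tau> x + 0 + (\<Sum>y\<in>V. w x y))" for x
        using degs[of x] by (simp add: \<tau>_def)
    qed auto
    have "good V w (\<lambda>x. 0) \<tau> X" if X: "X \<subseteq> V" "X \<noteq> {}" "X \<noteq> V" for X
    proof -
      have "6 * k \<le> card (cut_arcs A tail head X)"
        using assms(3) X by (auto simp: edge_connected_def)
      then have c: "3 * m - 3 \<le> deg V w (\<lambda>x. 0) X"
        unfolding deg_def cuts[OF X(1)] by (simp add: m_def)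
      have e: "even (deg V w (\<lambda>x. 0) X + nd (sum \<tau> X))"
        using deg_parity[OF bal X(1)] nd_parity[of "sum \<tau> X"] by simp
      \<comment> \<open>The connectivity \<open>6 * k\<close> equals \<open>3 * m - 3\<close>, which
        is even since \<open>m\<close> is odd. It falls short of the required bound only if
        \<open>r = m\<close>, and then parity raises the degree by 1.\<close>
      have "2 * m - 2 + r \<le> d" if "3 * m - 3 \<le> d" "even (d + r)" "r \<le> m" for d r
        using that m(2) by presburger
      from this[OF c e nd_le] show ?thesis by (simp add: good_def)
    qed
    \<comment> \<open>At the start the special vertex is isolated; all sets are good, so any value
      may fill the place of the exempt vertex.\<close>
    then have "admissible V w (\<lambda>x. 0) (\<lambda>x. 0) \<tau> undefined"
      using bal True nd_nonneg[of "sum \<tau> V"] m(1) by (simp add: admissible_def)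
    then have "realizable V w (\<lambda>x. \<tau> x + 0)" by (rule admissible_realizable)
    then obtain f where f: "orients w f" "\<And>x. x \<in> V \<Longrightarrow> 2 * m dvd (\<Sum>y\<in>V. f x y) - \<tau> x"
      unfolding realizable_def by auto
    obtain \<psi> where \<psi>: "\<forall>a\<in>A. \<psi> a = 1 \<or> \<psi> a = - 1"
      "\<And>x y. f x y = (\<Sum>a\<in>A. \<psi> a * arc (tail a) (head a) x y)"
      using orients_arcs[of A tail head f] fin(2) ends f(1) unfolding w_def by blast
    define \<phi> where "\<phi> = (\<lambda>a. if \<psi> a = 1 then 1 else 0 :: int)"
    have "[(\<Sum>a\<in>out_arcs A tail x. \<phi> a) - (\<Sum>a\<in>in_arcs A head x. \<phi> a) = \<beta> x] (mod m)" if x: "x \<in> V" for x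
    proof -
      have "(\<Sum>y\<in>V. f x y) = (\<Sum>a\<in>A. \<psi> a * (\<Sum>y\<in>V. arc (tail a) (head a) x y))"
        unfolding \<psi>(2) by (subst sum.swap) (simp add: sum_distrib_left)
      also have "\<dots> = (\<Sum>a\<in>A. 2 * ((if tail a = x then \<phi> a else 0) - (if head a = x then \<phi> a else 0))
          - (if tail a = x then 1 else if head a = x then - 1 else 0))"
      proof (intro sum.cong refl)
        fix a assume a: "a \<in> A"
        then have "\<psi> a = 2 * \<phi> a - 1" using \<psi>(1) by (auto simp: \<phi>_def)
        then show "\<psi> a * (\<Sum>y\<in>V. arc (tail a) (head a) x y)
            = 2 * ((if tail a = x then \<phi> a else 0) - (if head a = x then \<phi> a else 0))
              - (if tail a = x then 1 else if head a = x then - 1 else 0)"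
          using ends[OF a] fin(1) by (auto simp: sum_arc)
      qed
      also have "\<dots> = 2 * ((\<Sum>a\<in>out_arcs A tail x. \<phi> a) - (\<Sum>a\<in>in_arcs A head x. \<phi> a)) - io x"
        using fin(2)
        by (simp add: sum_subtractf sum_distrib_left[symmetric] io_def out_arcs_def in_arcs_def
            sum.inter_filter)
      finally have "2 * ((\<Sum>a\<in>out_arcs A tail x. \<phi> a) - (\<Sum>a\<in>in_arcs A head x. \<phi> a) - \<beta> x)
          = (\<Sum>y\<in>V. f x y) - \<tau> x"
        by (simp add: \<tau>_def)
      then have "2 * m dvd 2 * ((\<Sum>a\<in>out_arcs A tail x. \<phi> a) - (\<Sum>a\<in>in_arcs A head x. \<phi> a) - \<beta> x)"
        using f(2)[OF x] by (simp only:)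
      \<comment> \<open>Cancelling the factor 2 turns the modulus \<open>2 * m\<close> into
        \<open>m\<close>.\<close>
      then show ?thesis by (simp only: dvd_mult_cancel_left cong_iff_dvd_diff) simp
    qed
    moreover have "\<phi> a mod m \<in> {0, 1}" for a using m(1) by (simp add: \<phi>_def)
    ultimately show ?thesis
      unfolding is_flow_with_boundary_def m_def[symmetric] by blast
  qed
qed

end
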